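(* Let $f\colon M^m\to \mathbb{Q}_{k_1}^{n_1}\times \mathbb{Q}_{k_2}^{n_2}$ be an isometric immersion of a Riemannian manifold. Assume that $U\cap N_1^\perp$ is a vector subbundle of $N_fM$. Then $\nabla^\perp(U\cap N_1^\perp)\subset N_1^\perp$ if and only if the following two conditions hold: (i) $\nabla^\perp\mathcal{R}^\perp|_{U\cap N_1^\perp}=0$; (ii) $\nabla^\perp(U\cap N_1^\perp)\subset\{H\}^\perp$.
   Context: $\mathbb{Q}_k^n$ denotes, for $k\neq 0$, the hyperquadric $\{X\in\mathbb{R}^{n+1}_{\sigma(k)}:\langle X,X\rangle=1/k\}$ (a connected component of it if $k<0$), where $\sigma(k)=1$ if $k<0$, $\sigma(k)=0$ otherwise, and $\mathbb{R}^N_s$ is flat space of index $s$; $\mathbb{Q}_0^n=\mathbb{R}^n$. $N_fM$ is the normal bundle of $f$, $\nabla^\perp$ its normal connection, $\mathcal{R}^\perp$ the curvature tensor of $\nabla^\perp$, and $H$ the mean curvature vector field of $f$. Let $\pi_2$ be the orthogonal projection of $T(\mathbb{Q}_{k_1}^{n_1}\times\mathbb{Q}_{k_2}^{n_2})$ onto the subbundle tangent to the second factor. The tensor $T\colon N_fM\to N_fM$ is defined by letting $T\xi$ be the normal component of $\pi_2\xi$; put $U=\ker T$. $N_1(x)\subset N_fM(x)$ is the first normal space, spanned by the image of the second fundamental form of $f$ at $x$, and $N_1^\perp$ is its orthogonal complement in $N_fM$. For a subset $W$ of $N_fM$, $\nabla^\perp(U\cap N_1^\perp)\subset W$ means $\nabla^\perp_X\xi\in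 W$ for all $X\in TM$ and all smooth sections $\xi$ of $U\cap N_1^\perp$. Condition (i) means $(\nabla^\perp_Z\mathcal{R}^\perp)(X,Y,\xi)=0$ for all $X,Y,Z\in TM$ and $\xi\in U\cap N_1^\perp$, where $(\nabla^\perp_Z\mathcal{R}^\perp)(X,Y,\xi)=\nabla^\perp_Z\mathcal{R}^\perp(X,Y)\xi-\mathcal{R}^\perp(\nabla_ZX,Y)\xi-\mathcal{R}^\perp(X,\nabla_ZY)\xi-\mathcal{R}^\perp(X,Y)\nabla^\perp_Z\xi$. *)

theory Defs
  imports "HOL-Analysis.Analysis"
begin

section \<open>Smooth manifolds\<close>

text \<open>On an open set \<open>S\<close> of a Euclidean space, \<open>times_differentiable_on S f n\<close> says that \<open>f\<close> is
  \<open>n\<close> times continuously differentiable.\<close>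

primrec times_differentiable_on ::
    "'e::real_normed_vector set \<Rightarrow> ('e \<Rightarrow> 'b::real_normed_vector) \<Rightarrow> nat \<Rightarrow> bool" where
  "times_differentiable_on S f 0 \<longleftrightarrow> continuous_on S f"
| "times_differentiable_on S f (Suc n) \<longleftrightarrow>
     (\<forall>x\<in>S. f differentiable (at x)) \<and>
     (\<forall>v. times_differentiable_on S (\<lambda>x. frechet_derivative f (at x) v) n)"

definition smooth_on :: "'e::real_normed_vector set \<Rightarrow> ('e \<Rightarrow> 'b::real_normed_vector) \<Rightarrow> bool" where
  "smooth_on S f \<longleftrightarrow> (\<forall>n. times_differentiable_on S f n)"

type_synonym ('a, 'm) chart = "'a set \<times> ('a \<Rightarrow> real ^ 'm)"

abbreviation chart_inv :: "('a, 'm::finite) chart \<Rightarrow> real ^ 'm \<Rightarrow> 'a" where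
  "chart_inv c \<equiv> inv_into (fst c) (snd c)"

definition points :: "('a, 'm::finite) chart set \<Rightarrow> 'a set" where
  "points A = (\<Union>c\<in>A. fst c)"

definition smooth_atlas :: "'a topology \<Rightarrow> ('a, 'm::finite) chart set \<Rightarrow> bool" where
  "smooth_atlas T A \<longleftrightarrow>
     points A = topspace T \<and>
     (\<forall>c\<in>A. openin T (fst c) \<and> open (snd c ` fst c) \<and>
        homeomorphic_map (subtopology T (fst c)) (top_of_set (snd c ` fst c)) (snd c)) \<and>
     (\<forall>c\<in>A. \<forall>d\<in>A. smooth_on (snd c ` (fst c \<inter> fst d)) (snd d \<circ> chart_inv c))"

definition smooth_manifold :: "'a topology \<Rightarrow> ('a, 'm::finite) chart set \<Rightarrow> bool" where
  "smooth_manifold T A \<longleftrightarrow> Hausdorff_space T \<and> second_countable T \<and> smooth_atlas T A"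

definition smooth_map_on ::
    "('a, 'm::finite) chart set \<Rightarrow> 'a set \<Rightarrow> ('a \<Rightarrow> 'b::real_normed_vector) \<Rightarrow> bool" where
  "smooth_map_on A V F \<longleftrightarrow> (\<forall>c\<in>A. smooth_on (snd c ` (fst c \<inter> V)) (F \<circ> chart_inv c))"

abbreviation smooth_map :: "('a, 'm::finite) chart set \<Rightarrow> ('a \<Rightarrow> 'b::real_normed_vector) \<Rightarrow> bool" where
  "smooth_map A F \<equiv> smooth_map_on A (points A) F"

text \<open>A tangent vector at \<open>p\<close> is the derivation of the algebra of smooth functions on the manifold
  given by a linear combination of the coordinate derivations of a chart around \<open>p\<close>. It takes the
  dummy value 0 on functions that are not smooth, so that equality of tangent vectors is equality
  of functionals.\<close>

type_synonym 'a tvec = "('a \<Rightarrow> real) \<Rightarrow> real"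
type_synonym 'a vfield = "'a \<Rightarrow> 'a tvec"

definition tangent_space :: "('a, 'm::finite) chart set \<Rightarrow> 'a \<Rightarrow> 'a tvec set" where
  "tangent_space A p = {v. \<exists>c\<in>A. p \<in> fst c \<and> (\<exists>w.
     v = (\<lambda>h. if smooth_map A h
               then frechet_derivative (h \<circ> chart_inv c) (at (snd c p)) w else 0))}"

definition vector_fields :: "('a, 'm::finite) chart set \<Rightarrow> 'a vfield set" where
  "vector_fields A = {X. (\<forall>p\<in>points A. X p \<in> tangent_space A p) \<and>
     (\<forall>h. smooth_map A h \<longrightarrow> smooth_map A (\<lambda>p. X p h))}"

definition lie_bracket :: "'a vfield \<Rightarrow> 'a vfield \<Rightarrow> 'a vfield" where
  "lie_bracket X Y = (\<lambda>p h. X p (\<lambda>q. Y q h) - Y p (\<lambda>q. X q h))"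

text \<open>The derivative of a vector-valued map along a tangent vector, taken componentwise. Applied
  to an immersion \<open>f\<close> it is the differential of \<open>f\<close>.\<close>

definition deriv_along :: "'a tvec \<Rightarrow> ('a \<Rightarrow> 'b::euclidean_space) \<Rightarrow> 'b" where
  "deriv_along v F = (\<Sum>b\<in>Basis. v (\<lambda>q. F q \<bullet> b) *\<^sub>R b)"

section \<open>Riemannian metrics and the Levi-Civita connection\<close>

definition riemannian_metric ::
    "('a, 'm::finite) chart set \<Rightarrow> ('a \<Rightarrow> 'a tvec \<Rightarrow> 'a tvec \<Rightarrow> real) \<Rightarrow> bool" where
  "riemannian_metric A g \<longleftrightarrow>
     (\<forall>p\<in>points A. \<forall>u\<in>tangent_space A p. \<forall>v\<in>tangent_space A p. \<forall>w\<in>tangent_space A p.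
        g p u v = g p v u \<and>
        (\<forall>a b. g p (\<lambda>h. a * u h + b * v h) w = a * g p u w + b * g p v w) \<and>
        (u \<noteq> (\<lambda>h. 0) \<longrightarrow> g p u u > 0)) \<and>
     (\<forall>X\<in>vector_fields A. \<forall>Y\<in>vector_fields A. smooth_map A (\<lambda>p. g p (X p) (Y p)))"

definition riemannian_manifold ::
    "'a topology \<Rightarrow> ('a, 'm::finite) chart set \<Rightarrow> ('a \<Rightarrow> 'a tvec \<Rightarrow> 'a tvec \<Rightarrow> real) \<Rightarrow> bool" where
  "riemannian_manifold T A g \<longleftrightarrow> smooth_manifold T A \<and> riemannian_metric A g"

text \<open>The conditions determine \<open>nabla X Y p\<close> for all points \<open>p\<close> and vector fields \<open>X\<close>, \<open>Y\<close>.\<close>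

definition levi_civita_connection ::
    "('a, 'm::finite) chart set \<Rightarrow> ('a \<Rightarrow> 'a tvec \<Rightarrow> 'a tvec \<Rightarrow> real) \<Rightarrow>
     ('a vfield \<Rightarrow> 'a vfield \<Rightarrow> 'a vfield) \<Rightarrow> bool" where
  "levi_civita_connection A g nabla \<longleftrightarrow>
     (\<forall>X\<in>vector_fields A. \<forall>Y\<in>vector_fields A. \<forall>Z\<in>vector_fields A.
        nabla X Y \<in> vector_fields A \<and>
        (\<forall>p\<in>points A.
           nabla (\<lambda>q h. X q h + Y q h) Z p = (\<lambda>h. nabla X Z p h + nabla Y Z p h) \<and>
           nabla X (\<lambda>q h. Y q h + Z q h) p = (\<lambda>h. nabla X Y p h + nabla X Z p h) \<and>
           (\<forall>\<phi>. smooth_map A \<phi> \<longrightarrow>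
              nabla (\<lambda>q h. \<phi> q * X q h) Y p = (\<lambda>h. \<phi> p * nabla X Y p h) \<and>
              nabla X (\<lambda>q h. \<phi> q * Y q h) p = (\<lambda>h. X p \<phi> * Y p h + \<phi> p * nabla X Y p h)) \<and>
           (\<lambda>h. nabla X Y p h - nabla Y X p h) = lie_bracket X Y p \<and>
           X p (\<lambda>q. g q (Y q) (Z q)) = g p (nabla X Y p) (Z p) + g p (Y p) (nabla X Z p)))"

section \<open>The space forms and their products\<close>

text \<open>The first coordinate of \<open>\<real>\<^sup>n\<^sup>+\<^sup>1\<close> is the timelike one when \<open>k < 0\<close>. To have
  one ambient space for all \<open>k\<close>, the flat space form \<open>\<real>\<^sup>n\<close> is the
  hyperplane \<open>{0} \<times> \<real>\<^sup>n\<close> of Euclidean \<open>\<real>\<^sup>n\<^sup>+\<^sup>1\<close>.\<close>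

type_synonym 'n ambient = "real \<times> (real ^ 'n)"

definition flat_form :: "real \<Rightarrow> 'n::finite ambient \<Rightarrow> 'n ambient \<Rightarrow> real" where
  "flat_form k X Y = (if k < 0 then - (fst X * fst Y) else fst X * fst Y) + snd X \<bullet> snd Y"

definition space_form :: "real \<Rightarrow> 'n::finite ambient set" where
  "space_form k =
     (if k = 0 then {X. fst X = 0}
      else if k < 0 then {X. flat_form k X X = 1 / k \<and> fst X > 0}
      else {X. flat_form k X X = 1 / k})"

definition space_form_tangent :: "real \<Rightarrow> 'n::finite ambient \<Rightarrow> 'n ambient set" where
  "space_form_tangent k X = (if k = 0 then {v. fst v = 0} else {v. flat_form k X v = 0})"

type_synonym ('n1, 'n2) prod_ambient = "'n1 ambient \<times> 'n2 ambient"

definition prod_form ::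
    "real \<Rightarrow> real \<Rightarrow> ('n1::finite, 'n2::finite) prod_ambient \<Rightarrow> ('n1, 'n2) prod_ambient \<Rightarrow> real" where
  "prod_form k1 k2 X Y = flat_form k1 (fst X) (fst Y) + flat_form k2 (snd X) (snd Y)"

definition prod_tangent ::
    "real \<Rightarrow> real \<Rightarrow> ('n1::finite, 'n2::finite) prod_ambient \<Rightarrow> ('n1, 'n2) prod_ambient set" where
  "prod_tangent k1 k2 X = space_form_tangent k1 (fst X) \<times> space_form_tangent k2 (snd X)"

text \<open>Below, \<open>orth_proj\<close> is only used for subspaces \<open>W\<close> of some \<open>prod_tangent k1 k2 X\<close> with \<open>X\<close> in the
  product of the space forms, on which \<open>prod_form k1 k2\<close> is positive definite.\<close>

definition orth_proj :: "('b::real_vector \<Rightarrow> 'b \<Rightarrow> real) \<Rightarrow> 'b set \<Rightarrow> 'b \<Rightarrow> 'b" where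
  "orth_proj B W x = (THE y. y \<in> W \<and> (\<forall>z\<in>W. B (x - y) z = 0))"

definition isometric_immersion ::
    "('a, 'm::finite) chart set \<Rightarrow> ('a \<Rightarrow> 'a tvec \<Rightarrow> 'a tvec \<Rightarrow> real) \<Rightarrow> real \<Rightarrow> real \<Rightarrow>
     ('a \<Rightarrow> ('n1::finite, 'n2::finite) prod_ambient) \<Rightarrow> bool" where
  "isometric_immersion A g k1 k2 f \<longleftrightarrow>
     smooth_map A f \<and>
     (\<forall>p\<in>points A. f p \<in> space_form k1 \<times> space_form k2 \<and>
        inj_on (\<lambda>v. deriv_along v f) (tangent_space A p) \<and>
        (\<forall>v\<in>tangent_space A p. \<forall>w\<in>tangent_space A p.
           g p v w = prod_form k1 k2 (deriv_along v f) (deriv_along w f)))"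

section \<open>Extrinsic geometry of an immersion into a product of space forms\<close>

context
  fixes A :: "('a, 'm::finite) chart set"
    and g :: "'a \<Rightarrow> 'a tvec \<Rightarrow> 'a tvec \<Rightarrow> real"
    and k1 k2 :: real
    and f :: "'a \<Rightarrow> ('n1::finite, 'n2::finite) prod_ambient"
begin

definition normal_space :: "'a \<Rightarrow> ('n1, 'n2) prod_ambient set" where
  "normal_space p = {\<xi> \<in> prod_tangent k1 k2 (f p).
     \<forall>v\<in>tangent_space A p. prod_form k1 k2 \<xi> (deriv_along v f) = 0}"

definition normal_part :: "'a \<Rightarrow> ('n1, 'n2) prod_ambient \<Rightarrow> ('n1, 'n2) prod_ambient" where
  "normal_part p = orth_proj (prod_form k1 k2) (normal_space p)"

text \<open>The Levi-Civita connection of the product of the space forms, pulled back along \<open>f\<close>: the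
  tangential part of the flat derivative.\<close>

definition ambient_connection ::
    "'a \<Rightarrow> 'a tvec \<Rightarrow> ('a \<Rightarrow> ('n1, 'n2) prod_ambient) \<Rightarrow> ('n1, 'n2) prod_ambient" where
  "ambient_connection p v F =
     orth_proj (prod_form k1 k2) (prod_tangent k1 k2 (f p)) (deriv_along v F)"

definition normal_connection ::
    "'a vfield \<Rightarrow> ('a \<Rightarrow> ('n1, 'n2) prod_ambient) \<Rightarrow> 'a \<Rightarrow> ('n1, 'n2) prod_ambient" where
  "normal_connection X \<xi> p = normal_part p (ambient_connection p (X p) \<xi>)"

definition normal_curvature ::
    "'a vfield \<Rightarrow> 'a vfield \<Rightarrow> ('a \<Rightarrow> ('n1, 'n2) prod_ambient) \<Rightarrow> 'a \<Rightarrow> ('n1, 'n2) prod_ambient" where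
  "normal_curvature X Y \<xi> p =
     normal_connection X (normal_connection Y \<xi>) p
     - normal_connection Y (normal_connection X \<xi>) p
     - normal_connection (lie_bracket X Y) \<xi> p"

definition deriv_normal_curvature ::
    "('a vfield \<Rightarrow> 'a vfield \<Rightarrow> 'a vfield) \<Rightarrow> 'a vfield \<Rightarrow> 'a vfield \<Rightarrow> 'a vfield \<Rightarrow>
     ('a \<Rightarrow> ('n1, 'n2) prod_ambient) \<Rightarrow> 'a \<Rightarrow> ('n1, 'n2) prod_ambient" where
  "deriv_normal_curvature nabla Z X Y \<xi> p =
     normal_connection Z (normal_curvature X Y \<xi>) p
     - normal_curvature (nabla Z X) Y \<xi> p
     - normal_curvature X (nabla Z Y) \<xi> p
     - normal_curvature X Y (normal_connection Z \<xi>) p"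

text \<open>The second fundamental form on vector fields, and on tangent vectors at a point; the latter
  does not depend on the chosen extensions.\<close>

definition second_fundamental_form :: "'a vfield \<Rightarrow> 'a vfield \<Rightarrow> 'a \<Rightarrow> ('n1, 'n2) prod_ambient" where
  "second_fundamental_form X Y p =
     normal_part p (ambient_connection p (X p) (\<lambda>q. deriv_along (Y q) f))"

definition second_fundamental_form_at :: "'a \<Rightarrow> 'a tvec \<Rightarrow> 'a tvec \<Rightarrow> ('n1, 'n2) prod_ambient" where
  "second_fundamental_form_at p v w =
     second_fundamental_form (SOME X. X \<in> vector_fields A \<and> X p = v)
       (SOME Y. Y \<in> vector_fields A \<and> Y p = w) p"

definition orthonormal_frame :: "'a \<Rightarrow> ('m \<Rightarrow> 'a tvec) \<Rightarrow> bool" where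
  "orthonormal_frame p e \<longleftrightarrow>
     (\<forall>i. e i \<in> tangent_space A p) \<and> (\<forall>i j. g p (e i) (e j) = (if i = j then 1 else 0))"

definition mean_curvature :: "'a \<Rightarrow> ('n1, 'n2) prod_ambient" where
  "mean_curvature p = (THE \<eta>. \<forall>e. orthonormal_frame p e \<longrightarrow>
     \<eta> = (1 / real CARD('m)) *\<^sub>R (\<Sum>i\<in>UNIV. second_fundamental_form_at p (e i) (e i)))"

definition first_normal_space :: "'a \<Rightarrow> ('n1, 'n2) prod_ambient set" where
  "first_normal_space p =
     span {second_fundamental_form_at p v w | v w. v \<in> tangent_space A p \<and> w \<in> tangent_space A p}"

definition first_normal_perp :: "'a \<Rightarrow> ('n1, 'n2) prod_ambient set" where
  "first_normal_perp p =
     {\<xi> \<in> normal_space p. \<forall>\<eta>\<in>first_normal_space p. prod_form k1 k2 \<xi> \<eta> = 0}"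

definition mean_curvature_perp :: "'a \<Rightarrow> ('n1, 'n2) prod_ambient set" where
  "mean_curvature_perp p = {\<xi> \<in> normal_space p. prod_form k1 k2 \<xi> (mean_curvature p) = 0}"

definition second_factor_proj :: "'a \<Rightarrow> ('n1, 'n2) prod_ambient \<Rightarrow> ('n1, 'n2) prod_ambient" where
  "second_factor_proj p =
     orth_proj (prod_form k1 k2) ({0} \<times> space_form_tangent k2 (snd (f p)))"

definition T_tensor :: "'a \<Rightarrow> ('n1, 'n2) prod_ambient \<Rightarrow> ('n1, 'n2) prod_ambient" where
  "T_tensor p \<xi> = normal_part p (second_factor_proj p \<xi>)"

definition T_kernel :: "'a \<Rightarrow> ('n1, 'n2) prod_ambient set" where
  "T_kernel p = {\<xi> \<in> normal_space p. T_tensor p \<xi> = 0}"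

definition kernel_perp :: "'a \<Rightarrow> ('n1, 'n2) prod_ambient set" where
  "kernel_perp p = T_kernel p \<inter> first_normal_perp p"

text \<open>Subbundles of the normal bundle; the rank is only required to be locally constant.\<close>

definition vector_subbundle :: "'a topology \<Rightarrow> ('a \<Rightarrow> ('n1, 'n2) prod_ambient set) \<Rightarrow> bool" where
  "vector_subbundle T L \<longleftrightarrow>
     (\<forall>p\<in>points A. L p \<subseteq> normal_space p \<and>
        (\<exists>V r e. openin T V \<and> p \<in> V \<and>
           (\<forall>i<r. smooth_map_on A V (e i)) \<and>
           (\<forall>q\<in>V. inj_on (\<lambda>i. e i q) {..<(r::nat)} \<and>
                  independent ((\<lambda>i. e i q) ` {..<r}) \<and>
                  L q = span ((\<lambda>i. e i q) ` {..<r}))))"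

definition sections :: "('a \<Rightarrow> ('n1, 'n2) prod_ambient set) \<Rightarrow> ('a \<Rightarrow> ('n1, 'n2) prod_ambient) set" where
  "sections L = {\<xi>. smooth_map A \<xi> \<and> (\<forall>p\<in>points A. \<xi> p \<in> L p)}"

definition normal_derivatives_in ::
    "('a \<Rightarrow> ('n1, 'n2) prod_ambient set) \<Rightarrow> ('a \<Rightarrow> ('n1, 'n2) prod_ambient set) \<Rightarrow> bool" where
  "normal_derivatives_in L W \<longleftrightarrow>
     (\<forall>\<xi>\<in>sections L. \<forall>X\<in>vector_fields A. \<forall>p\<in>points A. normal_connection X \<xi> p \<in> W p)"

definition normal_curvature_parallel_on ::
    "('a vfield \<Rightarrow> 'a vfield \<Rightarrow> 'a vfield) \<Rightarrow> ('a \<Rightarrow> ('n1, 'n2) prod_ambient set) \<Rightarrow> bool" where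
  "normal_curvature_parallel_on nabla L \<longleftrightarrow>
     (\<forall>X\<in>vector_fields A. \<forall>Y\<in>vector_fields A. \<forall>Z\<in>vector_fields A. \<forall>\<xi>\<in>sections L.
        \<forall>p\<in>points A. deriv_normal_curvature nabla Z X Y \<xi> p = 0)"

end

end

theory Submission
  imports Defs
begin

text \<open>
  A vector of \<open>ker T\<close> is tangent to the first factor, so a section \<open>\<xi>\<close> of \<open>ker T \<inter> N\<^sub>1\<^sup>\<bottom>\<close> has
  vanishing shape operator, its flat derivative is already its normal derivative and is again
  tangent to the first factor, and \<open>R\<^sup>\<bottom>(X, Y) \<xi> = 0\<close>. If \<open>\<nabla>\<^sup>\<bottom>\<xi>\<close> stays in \<open>N\<^sub>1\<^sup>\<bottom>\<close>, it is therefore again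
  such a section, and both conditions follow. Conversely (i) gives \<open>R\<^sup>\<bottom>(X, Y) \<nabla>\<^sub>Z\<^sup>\<bottom>\<xi> = 0\<close>, which by the
  Ricci equation says that the shape operators of the vectors \<open>\<nabla>\<^sub>Z\<^sup>\<bottom>\<xi>\<close> commute. By the Codazzi equation
  the form \<open>\<langle>\<alpha>(Y, Z), \<nabla>\<^sub>X\<^sup>\<bottom>\<xi>\<rangle>\<close> is totally symmetric, and by (ii) it is trace-free. For a totally
  symmetric form with commuting operators the squared norm is a combination of traces, so the
  form vanishes.
\<close>

text \<open>The ambient curvature never has to be computed. The curvature tensor of the product acts
  within each factor, and it kills a normal vector tangent to the first factor: the pairing of that
  vector with the differential of \<open>f\<close> over the first factor alone is already the full
  one, hence 0. Inside the flat space this says that the flat derivative of such a field stays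
  tangent to the product, so every structure equation reduces to the commutation of flat
  derivatives. The normal derivative of a section keeps the tangency to the first factor whether or
  not it leaves the complement of the first normal space; this is what makes the Ricci equation
  available in the converse.

  Two obstacles account for the preparation. Connection and curvature act on globally defined
  fields, so tangent vectors at a point must be extended with cut-off functions. The normal
  projection is given by a description at each point, so its smoothness requires a formula, found by
  Gram-Schmidt on the coordinate derivatives of \<open>f\<close>; only then is a normal derivative a
  field that can be differentiated again.\<close>

section \<open>Differential calculus\<close>

lemma times_differentiable_on_cong:
  assumes "open S" "\<And>x. x \<in> S \<Longrightarrow> f x = g x"
  shows "times_differentiable_on S f n \<longleftrightarrow> times_differentiable_on S g n"
  using assms(2)
proof (induction n arbitrary: f g)
  case 0
  then show ?case by (simp cong: continuous_on_cong)
next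
  case (Suc n)
  have der: "(f has_derivative D) (at x) \<longleftrightarrow> (g has_derivative D) (at x)" if "x \<in> S" for x D
    using Suc.prems that assms(1)
    by (metis has_derivative_transform_within_open)
  then have "f differentiable (at x) \<longleftrightarrow> g differentiable (at x)" if "x \<in> S" for x
    using that by (auto simp: differentiable_def)
  \<comment> \<open>\<open>frechet_derivative\<close> is a choice among the admissible derivatives,
    so equal sets of these give the same choice.\<close>
  moreover have "frechet_derivative f (at x) = frechet_derivative g (at x)" if "x \<in> S" for x
    using der[OF that] by (simp add: frechet_derivative_def)
  ultimately show ?case
    using Suc.IH[of "\<lambda>x. frechet_derivative f (at x) v" "\<lambda>x. frechet_derivative g (at x) v" for v] by auto
qed

lemma smooth_on_cong:
  assumes "open S" "\<And>x. x \<in> S \<Longrightarrow> f x = g x"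
  shows "smooth_on S f \<longleftrightarrow> smooth_on S g"
  using times_differentiable_on_cong[OF assms] by (simp add: smooth_on_def)

text \<open>Any explicit derivative may replace the chosen \<open>frechet_derivative\<close>, so
  each closure rule below can run by induction on the order through its own differentiation
  formula.\<close>

lemma times_differentiable_on_SucI:
  assumes "open S" "\<And>x. x \<in> S \<Longrightarrow> (f has_derivative f' x) (at x)"
    and "\<And>v. times_differentiable_on S (\<lambda>x. f' x v) n"
  shows "times_differentiable_on S f (Suc n)"
proof -
  have "frechet_derivative f (at x) = f' x" if "x \<in> S" for x
    using frechet_derivative_at[OF assms(2)[OF that]] by simp
  then have "times_differentiable_on S (\<lambda>x. frechet_derivative f (at x) v) n" for v
    using assms(3)[of v] times_differentiable_on_cong[OF assms(1),
        of "\<lambda>x. frechet_derivative f (at x) v" "\<lambda>x. f' x v"] by simp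
  then show ?thesis
    using assms(2) by (auto simp: differentiable_def)
qed

text \<open>The product and chain rules leave one factor undifferentiated, and the induction
  hypothesis asks for that factor at one order less.\<close>

lemma times_differentiable_on_SucD:
  "times_differentiable_on S f (Suc n) \<Longrightarrow> times_differentiable_on S f n"
proof (induction n arbitrary: f)
  case 0
  then show ?case
    by (auto intro!: continuous_at_imp_continuous_on differentiable_imp_continuous_within)
next
  case (Suc n)
  then show ?case by (meson times_differentiable_on.simps(2))
qed

lemma times_differentiable_on_has_derivative:
  "times_differentiable_on S f (Suc n) \<Longrightarrow> x \<in> S \<Longrightarrow>
    (f has_derivative frechet_derivative f (at x)) (at x)"
  by (simp add: frechet_derivative_works)

lemma smooth_on_has_derivative:
  "smooth_on S f \<Longrightarrow> x \<in> S \<Longrightarrow> (f has_derivative frechet_derivative f (at x)) (at x)"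
  unfolding smooth_on_def by (metis times_differentiable_on_has_derivative)

lemma smooth_on_frechet_derivative:
  "smooth_on S f \<Longrightarrow> smooth_on S (\<lambda>x. frechet_derivative f (at x) v)"
  unfolding smooth_on_def by (metis times_differentiable_on.simps(2))

lemma times_differentiable_on_open_cover:
  assumes "\<And>x. x \<in> S \<Longrightarrow> \<exists>U. open U \<and> x \<in> U \<and> times_differentiable_on U f n"
  shows "times_differentiable_on S f n"
  using assms
proof (induction n arbitrary: f)
  case 0
  then show ?case
    by (metis continuous_at_imp_continuous_on continuous_on_eq_continuous_at times_differentiable_on.simps(1))
next
  case (Suc n)
  then show ?case by (metis times_differentiable_on.simps(2))
qed

lemma smooth_on_open_cover:
  assumes "\<And>x. x \<in> S \<Longrightarrow> \<exists>U. open U \<and> x \<in> U \<and> smooth_on U f"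
  shows "smooth_on S f"
  unfolding smooth_on_def
  by (metis assms smooth_on_def times_differentiable_on_open_cover)

lemma times_differentiable_on_const: "times_differentiable_on S (\<lambda>x. c) n"
  by (induction n arbitrary: c) auto

lemma smooth_on_const: "smooth_on S (\<lambda>x. c)"
  by (simp add: smooth_on_def times_differentiable_on_const)

lemma times_differentiable_on_linear:
  assumes "bounded_linear L" "open S"
  shows "times_differentiable_on S L n"
proof (cases n)
  case 0
  then show ?thesis using assms by (simp add: linear_continuous_on)
next
  case (Suc k)
  show ?thesis unfolding Suc
    by (rule times_differentiable_on_SucI[OF assms(2) bounded_linear_imp_has_derivative[OF assms(1)]])
      (rule times_differentiable_on_const)
qed

lemma smooth_on_linear: "bounded_linear L \<Longrightarrow> open S \<Longrightarrow> smooth_on S L"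
  by (simp add: smooth_on_def times_differentiable_on_linear)

lemma times_differentiable_on_add:
  assumes "open S" "times_differentiable_on S f n" "times_differentiable_on S g n"
  shows "times_differentiable_on S (\<lambda>x. f x + g x) n"
  using assms(2,3)
proof (induction n arbitrary: f g)
  case 0
  then show ?case by (simp add: continuous_on_add)
next
  case (Suc n)
  show ?case
    by (rule times_differentiable_on_SucI[OF assms(1)],
        rule has_derivative_add[OF times_differentiable_on_has_derivative[OF Suc.prems(1)]
          times_differentiable_on_has_derivative[OF Suc.prems(2)]])
      (use Suc in auto)
qed

lemma smooth_on_add:
  "open S \<Longrightarrow> smooth_on S f \<Longrightarrow> smooth_on S g \<Longrightarrow> smooth_on S (\<lambda>x. f x + g x)"
  by (simp add: smooth_on_def times_differentiable_on_add)

lemma times_differentiable_on_sum: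
  assumes "open S" "\<And>i. i \<in> I \<Longrightarrow> times_differentiable_on S (f i) n"
  shows "times_differentiable_on S (\<lambda>x. \<Sum>i\<in>I. f i x) n"
  using assms(2)
  by (induction I rule: infinite_finite_induct)
    (auto simp: times_differentiable_on_const intro!: times_differentiable_on_add[OF assms(1)])

lemma smooth_on_sum:
  "open S \<Longrightarrow> (\<And>i. i \<in> I \<Longrightarrow> smooth_on S (f i)) \<Longrightarrow> smooth_on S (\<lambda>x. \<Sum>i\<in>I. f i x)"
  by (simp add: smooth_on_def times_differentiable_on_sum)

lemma times_differentiable_on_bilinear:
  assumes "bounded_bilinear B" "open S" "times_differentiable_on S f n" "times_differentiable_on S g n"
  shows "times_differentiable_on S (\<lambda>x. B (f x) (g x)) n"
  using assms(3,4)
proof (induction n arbitrary: f g)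
  case 0
  then show ?case by (simp add: bounded_bilinear.continuous_on[OF assms(1)])
next
  case (Suc n)
  note D = Suc.prems[THEN times_differentiable_on_has_derivative]
  show ?case
    by (rule times_differentiable_on_SucI[OF assms(2) bounded_bilinear.FDERIV[OF assms(1) D]])
      (use Suc Suc.prems[THEN times_differentiable_on_SucD] in
        \<open>auto intro!: times_differentiable_on_add[OF assms(2)]\<close>)
qed

lemma smooth_on_bilinear:
  "bounded_bilinear B \<Longrightarrow> open S \<Longrightarrow> smooth_on S f \<Longrightarrow> smooth_on S g \<Longrightarrow>
    smooth_on S (\<lambda>x. B (f x) (g x))"
  by (simp add: smooth_on_def times_differentiable_on_bilinear)

lemmas smooth_on_scaleR = smooth_on_bilinear[OF bounded_bilinear_scaleR]
lemmas smooth_on_inner = smooth_on_bilinear[OF bounded_bilinear_inner]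

lemma smooth_on_mult:
  fixes f g :: "'e::real_normed_vector \<Rightarrow> 'b::real_normed_algebra"
  shows "open S \<Longrightarrow> smooth_on S f \<Longrightarrow> smooth_on S g \<Longrightarrow> smooth_on S (\<lambda>x. f x * g x)"
  by (rule smooth_on_bilinear[OF bounded_bilinear_mult])

lemma smooth_on_diff:
  assumes "open S" "smooth_on S f" "smooth_on S g"
  shows "smooth_on S (\<lambda>x. f x - g x)"
  using smooth_on_add[OF assms(1,2) smooth_on_scaleR[OF assms(1) smooth_on_const[of _ "-1"] assms(3)]]
  by simp

text \<open>In the chain rule the direction \<open>?Dg x v\<close> varies with \<open>x\<close>,
  while the induction covers derivatives of \<open>f\<close> in fixed directions. Expanding the
  direction in a basis of the intermediate space yields a finite sum of scalars times compositions;
  hence the Euclidean type of that space.\<close>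

lemma times_differentiable_on_compose:
  fixes g :: "'e::real_normed_vector \<Rightarrow> 'd::euclidean_space"
  assumes "open S" "open R" "g ` S \<subseteq> R"
    and "times_differentiable_on S g n" "times_differentiable_on R f n"
  shows "times_differentiable_on S (\<lambda>x. f (g x)) n"
  using assms(4,5)
proof (induction n arbitrary: f)
  case 0
  then show ?case using assms(3) by (auto intro: continuous_on_compose2)
next
  case (Suc n)
  let ?Df = "\<lambda>y. frechet_derivative f (at y)" and ?Dg = "\<lambda>x. frechet_derivative g (at x)"
  have Df: "(f has_derivative ?Df (g x)) (at (g x))" if "x \<in> S" for x
    using times_differentiable_on_has_derivative[OF Suc.prems(2)] assms(3) that by auto
  note Dg = times_differentiable_on_has_derivative[OF Suc.prems(1)]
  have "((\<lambda>x. f (g x)) has_derivative (\<lambda>v. \<Sum>b\<in>Basis. (?Dg x v \<bullet> b) *\<^sub>R ?Df (g x) b)) (at x)"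
    if "x \<in> S" for x
  proof -
    have lin: "linear (?Df (g x))"
      using Df[OF that] by (simp add: has_derivative_linear)
    have "?Df (g x) (?Dg x v) = (\<Sum>b\<in>Basis. (?Dg x v \<bullet> b) *\<^sub>R ?Df (g x) b)" for v
    proof -
      have "?Df (g x) (?Dg x v) = ?Df (g x) (\<Sum>b\<in>Basis. (?Dg x v \<bullet> b) *\<^sub>R b)"
        by (simp add: euclidean_representation)
      then show ?thesis
        by (simp add: linear_sum[OF lin] linear_scale[OF lin])
    qed
    then show ?thesis
      using has_derivative_compose[OF Dg[OF that] Df[OF that]] by simp
  qed
  then show ?case
    by (rule times_differentiable_on_SucI[OF assms(1)])
      (use Suc.prems Suc.prems[THEN times_differentiable_on_SucD] in
        \<open>auto intro!: times_differentiable_on_sum[OF assms(1)] Suc.IH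
          times_differentiable_on_bilinear[OF bounded_bilinear_scaleR assms(1)]
          times_differentiable_on_bilinear[OF bounded_bilinear_inner assms(1)]
          times_differentiable_on_const\<close>)
qed

lemma smooth_on_compose:
  fixes g :: "'e::real_normed_vector \<Rightarrow> 'd::euclidean_space"
  shows "open S \<Longrightarrow> open R \<Longrightarrow> g ` S \<subseteq> R \<Longrightarrow> smooth_on S g \<Longrightarrow> smooth_on R f \<Longrightarrow>
    smooth_on S (\<lambda>x. f (g x))"
  by (simp add: smooth_on_def times_differentiable_on_compose)

lemma smooth_on_linear_compose:
  fixes g :: "'e::real_normed_vector \<Rightarrow> 'd::euclidean_space"
  shows "open S \<Longrightarrow> bounded_linear L \<Longrightarrow> smooth_on S g \<Longrightarrow> smooth_on S (\<lambda>x. L (g x))"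
  by (rule smooth_on_compose[OF _ open_UNIV]) (auto intro: smooth_on_linear)

lemma smooth_on_inverse_real: "smooth_on (- {0}) (inverse :: real \<Rightarrow> real)"
proof -
  have "times_differentiable_on (- {0}) (inverse :: real \<Rightarrow> real) n" for n
  proof (induction n)
    case 0
    then show ?case by (auto intro!: continuous_on_inverse)
  next
    case (Suc n)
    have "(inverse has_derivative (\<lambda>v. inverse x * (- v) * inverse x)) (at x)"
      if "x \<in> - {0}" for x :: real
      using has_derivative_inverse'[of x UNIV] that by simp
    moreover have "times_differentiable_on (- {0}) (\<lambda>x::real. inverse x * (- v) * inverse x) n" for v
      by (rule times_differentiable_on_bilinear[OF bounded_bilinear_mult]
          Suc times_differentiable_on_const open_Compl closed_singleton)+
    ultimately show ?case
      by (intro times_differentiable_on_SucI) auto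
  qed
  then show ?thesis by (simp add: smooth_on_def)
qed

lemma smooth_on_divide:
  fixes f g :: "'e::real_normed_vector \<Rightarrow> real"
  assumes "open S" "smooth_on S f" "smooth_on S g" "\<And>x. x \<in> S \<Longrightarrow> g x \<noteq> 0"
  shows "smooth_on S (\<lambda>x. f x / g x)"
  unfolding divide_inverse
  by (intro smooth_on_mult assms smooth_on_compose[OF assms(1) _ _ assms(3) smooth_on_inverse_real])
    (use assms(4) in auto)

section \<open>A smooth cut-off function\<close>

text \<open>The class of functions \<open>P (1/x) exp (-1/x)\<close> on the positive half line, with \<open>P\<close> a polynomial,
  is closed under differentiation.\<close>

definition flat_function :: "real poly \<Rightarrow> real \<Rightarrow> real" where
  "flat_function P x = (if x > 0 then poly P (1 / x) * exp (- (1 / x)) else 0)"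

lemma poly_times_exp_minus_tendsto_0: "((\<lambda>t. poly P t * exp (- t)) \<longlongrightarrow> (0::real)) at_top"
proof -
  have "((\<lambda>t. \<Sum>i\<le>degree P. coeff P i * (t ^ i / exp t)) \<longlongrightarrow> (\<Sum>i\<le>degree P. coeff P i * 0)) at_top"
    by (intro tendsto_intros tendsto_power_div_exp_0)
  then show ?thesis
    by (simp add: poly_altdef exp_minus field_simps sum_divide_distrib sum_distrib_left)
qed

text \<open>With \<open>t = 1 / x\<close> the derivative in \<open>x\<close> is \<open>- t^2\<close>
  times the derivative in \<open>t\<close>, and the latter turns \<open>P\<close> into
  \<open>pderiv P - P\<close> in front of the exponential; this is the origin of the new polynomial.
  Only the point 0 needs a limit.\<close>

lemma flat_function_has_real_derivative:
  "(flat_function P has_real_derivative flat_function ([:0, 0, 1:] * (P - pderiv P)) x) (at x)"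
proof -
  consider "x > 0" | "x < 0" | "x = 0" by linarith
  then show ?thesis
  proof cases
    case 1
    have "((\<lambda>x. poly P (1 / x) * exp (- (1 / x))) has_real_derivative
        flat_function ([:0, 0, 1:] * (P - pderiv P)) x) (at x)"
      using 1 by (auto intro!: derivative_eq_intros poly_DERIV[THEN DERIV_chain2]
          simp: flat_function_def field_simps power2_eq_square)
    then show ?thesis
      by (rule has_field_derivative_transform_within_open[of _ _ _ "{0<..}"])
        (use 1 in \<open>auto simp: flat_function_def\<close>)
  next
    case 2
    have "((\<lambda>x. 0) has_real_derivative flat_function ([:0, 0, 1:] * (P - pderiv P)) x) (at x)"
      using 2 by (simp add: flat_function_def)
    then show ?thesis
      by (rule has_field_derivative_transform_within_open[of _ _ _ "{..<0}"])
        (use 2 in \<open>auto simp: flat_function_def\<close>)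
  next
    case 3
    \<comment> \<open>Dividing by \<open>h\<close> in the difference quotient multiplies the
      polynomial by its variable \<open>1 / h\<close>, which is what \<open>pCons 0 P\<close>
      encodes.\<close>
    have "((\<lambda>h. poly (pCons 0 P) (inverse h) * exp (- inverse h)) \<longlongrightarrow> 0) (at_right 0)"
      by (rule filterlim_compose[OF poly_times_exp_minus_tendsto_0 filterlim_inverse_at_top_right])
    then have "((\<lambda>h. flat_function P h / h) \<longlongrightarrow> 0) (at_right 0)"
      by (rule Lim_transform_eventually)
        (auto simp: eventually_at_filter flat_function_def field_simps)
    moreover have "((\<lambda>h. flat_function P h / h) \<longlongrightarrow> 0) (at_left 0)"
      by (rule Lim_transform_eventually[OF tendsto_const])
        (auto simp: eventually_at_filter flat_function_def)
    ultimately have "((\<lambda>h. flat_function P h / h) \<longlongrightarrow> 0) (at 0)"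
      by (simp add: filterlim_split_at)
    then show ?thesis using 3 by (simp add: DERIV_def flat_function_def)
  qed
qed

lemma smooth_on_flat_function: "smooth_on UNIV (flat_function P)"
proof -
  have "times_differentiable_on UNIV (flat_function P) n" for n P
  proof (induction n arbitrary: P)
    case 0
    then show ?case
      by (simp add: DERIV_continuous continuous_at_imp_continuous_on DERIV_isCont[OF flat_function_has_real_derivative])
  next
    case (Suc n)
    show ?case
      by (rule times_differentiable_on_SucI[OF _
            flat_function_has_real_derivative[unfolded has_field_derivative_def]])
        (auto intro!: times_differentiable_on_bilinear[OF bounded_bilinear_mult] Suc
          times_differentiable_on_const)
  qed
  then show ?thesis by (simp add: smooth_on_def)
qed

text \<open>The function is \<open>exp (- 1 / (r^2 - |x - a|^2))\<close> in the ball, continued by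
  0. A nonzero value at the centre is enough, since later constructions divide by it or cancel it;
  no plateau is built.\<close>

lemma bump_function:
  fixes a :: "'e::euclidean_space"
  assumes "0 < r"
  obtains \<beta> :: "'e \<Rightarrow> real"
  where "smooth_on UNIV \<beta>" "\<beta> a \<noteq> 0" "\<And>x. x \<notin> cball a r \<Longrightarrow> \<beta> x = 0"
proof
  let ?b = "\<lambda>x. flat_function 1 (r\<^sup>2 - (x - a) \<bullet> (x - a))"
  show "smooth_on UNIV ?b"
    by (rule smooth_on_compose[OF _ open_UNIV _ _ smooth_on_flat_function])
      (auto intro!: smooth_on_diff smooth_on_inner smooth_on_const
        smooth_on_linear[OF bounded_linear_ident])
  show "?b a \<noteq> 0" using assms by (simp add: flat_function_def)
  show "?b x = 0" if "x \<notin> cball a r" for x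
  proof -
    have "r\<^sup>2 < (norm (x - a))\<^sup>2"
      using that assms by (intro power_strict_mono) (auto simp: dist_norm norm_minus_commute)
    then show ?thesis by (simp add: flat_function_def dot_square_norm)
  qed
qed

section \<open>Smooth manifolds\<close>

lemma deriv_along_real [simp]: "deriv_along v (h :: 'a \<Rightarrow> real) = v h"
  by (simp add: deriv_along_def)

text \<open>The functional inside the definition of \<open>tangent_space\<close>, with chart and
  coefficients as parameters; \<open>x\<close> is a coordinate point, not a point of the
  manifold.\<close>

definition coord_vec :: "('a, 'm::finite) chart set \<Rightarrow> ('a, 'm) chart \<Rightarrow> real ^ 'm \<Rightarrow> real ^ 'm \<Rightarrow> 'a tvec" where
  "coord_vec A c x w =
    (\<lambda>h. if smooth_map A h then frechet_derivative (h \<circ> chart_inv c) (at x) w else 0)"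

locale manifold =
  fixes T :: "'a topology" and A :: "('a, 'm::finite) chart set"
  assumes smooth_manifold: "smooth_manifold T A"
begin

lemma openin_chart: "c \<in> A \<Longrightarrow> openin T (fst c)"
  using smooth_manifold by (simp add: smooth_manifold_def smooth_atlas_def)

lemma topspace_eq: "topspace T = points A"
  using smooth_manifold by (simp add: smooth_manifold_def smooth_atlas_def)

lemma open_chart_image: "c \<in> A \<Longrightarrow> open (snd c ` fst c)"
  using smooth_manifold by (simp add: smooth_manifold_def smooth_atlas_def)

lemma homeomorphic_chart:
  "c \<in> A \<Longrightarrow> homeomorphic_map (subtopology T (fst c)) (top_of_set (snd c ` fst c)) (snd c)"
  using smooth_manifold by (simp add: smooth_manifold_def smooth_atlas_def)

lemma smooth_transition:
  "c \<in> A \<Longrightarrow> d \<in> A \<Longrightarrow> smooth_on (snd c ` (fst c \<inter> fst d)) (snd d \<circ> chart_inv c)"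
  using smooth_manifold by (simp add: smooth_manifold_def smooth_atlas_def)

lemma chart_subset_points: "c \<in> A \<Longrightarrow> fst c \<subseteq> points A"
  by (auto simp: points_def)

lemma topspace_chart: "c \<in> A \<Longrightarrow> topspace (subtopology T (fst c)) = fst c"
  using chart_subset_points[of c] topspace_eq by (simp add: inf.absorb2)

lemma inj_on_chart: "c \<in> A \<Longrightarrow> inj_on (snd c) (fst c)"
  using homeomorphic_imp_injective_map[OF homeomorphic_chart] topspace_chart by metis

lemma chart_inv_chart: "c \<in> A \<Longrightarrow> q \<in> fst c \<Longrightarrow> chart_inv c (snd c q) = q"
  by (simp add: inj_on_chart)

lemma open_chart_image_of_open:
  assumes "c \<in> A" "openin T V"
  shows "open (snd c ` (fst c \<inter> V))"
proof -
  have "openin (subtopology T (fst c)) (fst c \<inter> V)"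
    using assms(2) by (simp add: openin_subtopology_Int2)
  then have "openin (top_of_set (snd c ` fst c)) (snd c ` (fst c \<inter> V))"
    using homeomorphic_imp_open_map[OF homeomorphic_chart[OF assms(1)]] by (simp add: open_map_def)
  then show ?thesis
    using open_chart_image[OF assms(1)] by (simp add: openin_open_eq)
qed

lemma smooth_map_iff:
  "smooth_map A F \<longleftrightarrow> (\<forall>c\<in>A. smooth_on (snd c ` fst c) (F \<circ> chart_inv c))"
proof -
  have "fst c \<inter> points A = fst c" if "c \<in> A" for c
    using chart_subset_points[OF that] by auto
  then show ?thesis by (simp add: smooth_map_on_def)
qed

lemma smooth_mapI: "(\<And>c. c \<in> A \<Longrightarrow> smooth_on (snd c ` fst c) (\<lambda>x. F (chart_inv c x))) \<Longrightarrow> smooth_map A F"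
  by (simp add: smooth_map_iff comp_def)

lemma smooth_mapD: "smooth_map A F \<Longrightarrow> c \<in> A \<Longrightarrow> smooth_on (snd c ` fst c) (\<lambda>x. F (chart_inv c x))"
  by (simp add: smooth_map_iff comp_def)

lemma chart_inv_in_points: "c \<in> A \<Longrightarrow> x \<in> snd c ` fst c \<Longrightarrow> chart_inv c x \<in> points A"
  by (meson chart_subset_points inv_into_into subsetD)

lemma smooth_map_cong:
  assumes "\<And>q. q \<in> points A \<Longrightarrow> F q = G q"
  shows "smooth_map A F \<longleftrightarrow> smooth_map A G"
proof -
  have "smooth_on (snd c ` fst c) (F \<circ> chart_inv c) \<longleftrightarrow> smooth_on (snd c ` fst c) (G \<circ> chart_inv c)"
    if "c \<in> A" for c
    by (rule smooth_on_cong[OF open_chart_image[OF that]])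
      (simp add: assms chart_inv_in_points[OF that])
  then show ?thesis by (simp add: smooth_map_iff)
qed

lemma smooth_map_const: "smooth_map A (\<lambda>q. a)"
  by (rule smooth_mapI) (rule smooth_on_const)

lemma smooth_map_bilinear:
  "bounded_bilinear B \<Longrightarrow> smooth_map A F \<Longrightarrow> smooth_map A G \<Longrightarrow> smooth_map A (\<lambda>q. B (F q) (G q))"
  by (rule smooth_mapI, rule smooth_on_bilinear) (auto intro: open_chart_image smooth_mapD)

lemma smooth_map_sum:
  "(\<And>i. i \<in> I \<Longrightarrow> smooth_map A (F i)) \<Longrightarrow> smooth_map A (\<lambda>q. \<Sum>i\<in>I. F i q)"
  by (rule smooth_mapI, rule smooth_on_sum) (auto intro: open_chart_image smooth_mapD)

lemmas smooth_map_scaleR = smooth_map_bilinear[OF bounded_bilinear_scaleR]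
lemmas smooth_map_inner = smooth_map_bilinear[OF bounded_bilinear_inner]

lemma smooth_map_linear:
  fixes F :: "'a \<Rightarrow> 'b::euclidean_space"
  assumes "bounded_linear L" "smooth_map A F"
  shows "smooth_map A (\<lambda>q. L (F q))"
  using smooth_on_linear_compose[OF open_chart_image assms(1) smooth_mapD[OF assms(2)]]
  by (rule smooth_mapI)

text \<open>The frontier of the chart domain is the only delicate place, and there the Hausdorff property
  makes the compact support of the cut-off closed in the whole manifold.\<close>

lemma smooth_map_cutoff:
  fixes u :: "real ^ 'm \<Rightarrow> 'b::real_normed_vector"
  assumes c: "c \<in> A" and K: "cball a r \<subseteq> snd c ` fst c"
    and \<beta>: "smooth_on UNIV \<beta>" "\<And>x. x \<notin> cball a r \<Longrightarrow> \<beta> x = 0"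
    and u: "smooth_on (snd c ` fst c) u"
  shows "smooth_map A (\<lambda>q. if q \<in> fst c then \<beta> (snd c q) *\<^sub>R u (snd c q) else 0)" (is "smooth_map A ?F")
proof (rule smooth_mapI)
  fix d assume d: "d \<in> A"
  let ?K = "chart_inv c ` cball a r"
  have "homeomorphic_maps (subtopology T (fst c)) (top_of_set (snd c ` fst c)) (snd c) (chart_inv c)"
  proof -
    obtain g where g: "homeomorphic_maps (subtopology T (fst c)) (top_of_set (snd c ` fst c)) (snd c) g"
      using homeomorphic_chart[OF c] by (auto simp: homeomorphic_map_maps)
    have "g x = chart_inv c x" if "x \<in> snd c ` fst c" for x
      using that g chart_inv_chart[OF c] topspace_chart[OF c] by (auto simp: homeomorphic_maps_def)
    then show ?thesis
      using g by (auto elim!: homeomorphic_maps_eq)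
  qed
  then have "continuous_map (top_of_set (snd c ` fst c)) T (chart_inv c)"
    by (simp add: homeomorphic_maps_def continuous_map_in_subtopology)
  moreover have "compactin (top_of_set (snd c ` fst c)) (cball a r)"
    using K by (simp add: compactin_subtopology)
  ultimately have "compactin T ?K"
    by (rule image_compactin[rotated])
  then have "closedin T ?K"
    using smooth_manifold by (simp add: smooth_manifold_def compactin_imp_closedin)
  then have "openin T (topspace T - ?K)" by blast
  then have opK: "open (snd d ` (fst d \<inter> (topspace T - ?K)))"
    by (rule open_chart_image_of_open[OF d])
  have opcd: "open (snd d ` (fst d \<inter> fst c))"
    by (rule open_chart_image_of_open[OF d openin_chart[OF c]])
  show "smooth_on (snd d ` fst d) (\<lambda>x. ?F (chart_inv d x))"
  proof (rule smooth_on_open_cover)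
    fix x assume "x \<in> snd d ` fst d"
    then obtain q where q: "q \<in> fst d" "x = snd d q" by auto
    show "\<exists>U. open U \<and> x \<in> U \<and> smooth_on U (\<lambda>x. ?F (chart_inv d x))"
    proof (cases "q \<in> fst c")
      case True
      let ?U = "snd d ` (fst d \<inter> fst c)"
      have tr: "smooth_on ?U (\<lambda>y. snd c (chart_inv d y))"
        using smooth_transition[OF d c] by (simp add: comp_def)
      have "smooth_on ?U (\<lambda>y. \<beta> (snd c (chart_inv d y)) *\<^sub>R u (snd c (chart_inv d y)))"
        by (rule smooth_on_scaleR[OF opcd smooth_on_compose[OF opcd open_UNIV _ tr \<beta>(1)]
            smooth_on_compose[OF opcd open_chart_image[OF c] _ tr u]])
          (auto simp: chart_inv_chart[OF d])
      then have "smooth_on ?U (\<lambda>x. ?F (chart_inv d x))"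
        by (subst smooth_on_cong[OF opcd]) (auto simp: chart_inv_chart[OF d])
      then show ?thesis using opcd q True by blast
    next
      case False
      let ?U = "snd d ` (fst d \<inter> (topspace T - ?K))"
      have F0: "?F y = 0" if "y \<notin> ?K" for y
      proof -
        have "snd c y \<notin> cball a r" if "y \<in> fst c"
          using \<open>y \<notin> ?K\<close> chart_inv_chart[OF c that] by (metis imageI)
        then show ?thesis by (simp add: \<beta>(2))
      qed
      have "smooth_on ?U (\<lambda>x. ?F (chart_inv d x)) \<longleftrightarrow> smooth_on ?U (\<lambda>x. 0::'b)"
      proof (rule smooth_on_cong[OF opK])
        fix x assume "x \<in> ?U"
        then have "chart_inv d x \<notin> ?K" by (auto simp: chart_inv_chart[OF d])
        then show "?F (chart_inv d x) = 0" by (rule F0)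
      qed
      moreover have "q \<notin> ?K"
      proof
        assume "q \<in> ?K"
        then obtain z where "q = chart_inv c z" "z \<in> snd c ` fst c" using K by blast
        then show False using False by (simp add: inv_into_into)
      qed
      ultimately show ?thesis
        using opK q chart_subset_points[OF d] topspace_eq smooth_on_const by blast
    qed
  qed
qed

section \<open>Tangent vectors and derivatives in charts\<close>

lemma smooth_map_has_derivative:
  assumes "smooth_map A F" "c \<in> A" "p \<in> fst c"
  shows "((\<lambda>x. F (chart_inv c x)) has_derivative
    frechet_derivative (\<lambda>x. F (chart_inv c x)) (at (snd c p))) (at (snd c p))"
  using smooth_on_has_derivative[OF smooth_mapD[OF assms(1,2)]] assms(3) by blast

lemma coord_vec_apply:
  "smooth_map A h \<Longrightarrow> coord_vec A c x w h = frechet_derivative (\<lambda>x. h (chart_inv c x)) (at x) w"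
  by (simp add: coord_vec_def comp_def)

text \<open>Smoothness of \<open>F\<close> keeps every component away from the default value 0 that
  tangent vectors take on non-smooth functions, so the componentwise derivative is the genuine
  one.\<close>

lemma deriv_along_coord_vec:
  fixes F :: "'a \<Rightarrow> 'b::euclidean_space"
  assumes "smooth_map A F" "c \<in> A" "p \<in> fst c"
  shows "deriv_along (coord_vec A c (snd c p) w) F =
    frechet_derivative (\<lambda>x. F (chart_inv c x)) (at (snd c p)) w"
proof -
  let ?D = "frechet_derivative (\<lambda>x. F (chart_inv c x)) (at (snd c p))"
  have "coord_vec A c (snd c p) w (\<lambda>q. F q \<bullet> b) = ?D w \<bullet> b" for b
  proof -
    have "((\<lambda>x. F (chart_inv c x) \<bullet> b) has_derivative (\<lambda>w. ?D w \<bullet> b)) (at (snd c p))"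
      by (rule has_derivative_inner_left[OF smooth_map_has_derivative[OF assms]])
    then have "frechet_derivative (\<lambda>x. F (chart_inv c x) \<bullet> b) (at (snd c p)) = (\<lambda>w. ?D w \<bullet> b)"
      by (rule frechet_derivative_at[symmetric])
    moreover have "smooth_map A (\<lambda>q. F q \<bullet> b)"
      by (rule smooth_map_inner[OF assms(1) smooth_map_const])
    ultimately show ?thesis by (simp add: coord_vec_apply)
  qed
  then show ?thesis by (simp add: deriv_along_def euclidean_representation)
qed

lemma coord_vec_lincomb:
  assumes "c \<in> A" "p \<in> fst c"
  shows "coord_vec A c (snd c p) (a *\<^sub>R w + b *\<^sub>R w') =
    (\<lambda>h. a * coord_vec A c (snd c p) w h + b * coord_vec A c (snd c p) w' h)"
proof
  fix h
  show "coord_vec A c (snd c p) (a *\<^sub>R w + b *\<^sub>R w') h =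
    a * coord_vec A c (snd c p) w h + b * coord_vec A c (snd c p) w' h"
  proof (cases "smooth_map A h")
    case True
    have "linear (frechet_derivative (\<lambda>x. h (chart_inv c x)) (at (snd c p)))"
      using smooth_map_has_derivative[OF True assms] by (rule has_derivative_linear)
    then show ?thesis
      by (simp add: coord_vec_apply True linear_add linear_scale)
  qed (simp add: coord_vec_def)
qed

text \<open>The definition admits every chart around \<open>p\<close>. The derivative of the
  transition map converts the coefficients, so one chart already yields all tangent vectors.\<close>

lemma tangent_space_eq_range:
  assumes c: "c \<in> A" and p: "p \<in> fst c"
  shows "tangent_space A p = range (coord_vec A c (snd c p))"
proof
  show "range (coord_vec A c (snd c p)) \<subseteq> tangent_space A p"
  proof
    fix v assume "v \<in> range (coord_vec A c (snd c p))"
    then show "v \<in> tangent_space A p"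
      using assms unfolding tangent_space_def coord_vec_def by blast
  qed
  show "tangent_space A p \<subseteq> range (coord_vec A c (snd c p))"
  proof
    fix v assume "v \<in> tangent_space A p"
    then obtain d w where d: "d \<in> A" "p \<in> fst d" and v: "v = coord_vec A d (snd d p) w"
      by (auto simp: tangent_space_def coord_vec_def)
    let ?tr = "\<lambda>x. snd c (chart_inv d x)"
    let ?U = "snd d ` (fst d \<inter> fst c)"
    have opU: "open ?U" by (rule open_chart_image_of_open[OF d(1) openin_chart[OF c]])
    have xU: "snd d p \<in> ?U" using d p by auto
    have tr: "(?tr has_derivative frechet_derivative ?tr (at (snd d p))) (at (snd d p))"
      using smooth_on_has_derivative[OF smooth_transition[OF d(1) c] xU] by (simp add: comp_def)
    have "v h = coord_vec A c (snd c p) (frechet_derivative ?tr (at (snd d p)) w) h" for h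
    proof (cases "smooth_map A h")
      case True
      let ?D = "frechet_derivative (\<lambda>x. h (chart_inv c x)) (at (snd c p))"
      have "((\<lambda>x. h (chart_inv c x)) has_derivative ?D) (at (?tr (snd d p)))"
        using smooth_map_has_derivative[OF True c p] chart_inv_chart[OF d] by simp
      then have "((\<lambda>x. h (chart_inv c (?tr x))) has_derivative
          (\<lambda>w. ?D (frechet_derivative ?tr (at (snd d p)) w))) (at (snd d p))"
        by (rule has_derivative_compose[OF tr])
      then have "((\<lambda>x. h (chart_inv d x)) has_derivative
          (\<lambda>w. ?D (frechet_derivative ?tr (at (snd d p)) w))) (at (snd d p))"
        by (rule has_derivative_transform_within_open[OF _ opU xU])
          (auto simp: chart_inv_chart[OF d(1)] chart_inv_chart[OF c])
      then show ?thesis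
        using True by (simp add: v coord_vec_apply frechet_derivative_at[symmetric])
    qed (simp add: v coord_vec_def)
    then show "v \<in> range (coord_vec A c (snd c p))" by blast
  qed
qed

lemma pointsE:
  assumes "p \<in> points A" obtains c where "c \<in> A" "p \<in> fst c"
  using assms by (auto simp: points_def)

lemma tangent_vectorE:
  assumes "p \<in> points A" "v \<in> tangent_space A p"
  obtains c w where "c \<in> A" "p \<in> fst c" "v = coord_vec A c (snd c p) w"
  using assms by (metis pointsE tangent_space_eq_range imageE)

lemma tangent_space_lincomb:
  assumes "p \<in> points A" "u \<in> tangent_space A p" "v \<in> tangent_space A p"
  shows "(\<lambda>h. a * u h + b * v h) \<in> tangent_space A p"
proof -
  obtain c where c: "c \<in> A" "p \<in> fst c" using assms(1) by (rule pointsE)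
  then show ?thesis
    using assms(2,3) unfolding tangent_space_eq_range[OF c]
    by (auto simp: coord_vec_lincomb[OF c, symmetric])
qed

text \<open>A tangent vector is a functional on functions of the whole type, whereas geometric
  identities hold on \<open>points A\<close> only. Charts see nothing outside
  \<open>points A\<close>, so the two functions have the same derivative.\<close>

lemma deriv_along_cong:
  fixes F :: "'a \<Rightarrow> 'b::euclidean_space"
  assumes p: "p \<in> points A" "v \<in> tangent_space A p" and F: "smooth_map A F"
    and eq: "\<And>q. q \<in> points A \<Longrightarrow> F q = G q"
  shows "deriv_along v F = deriv_along v G"
proof -
  obtain c w where c: "c \<in> A" "p \<in> fst c" and v: "v = coord_vec A c (snd c p) w"
    using p by (rule tangent_vectorE)
  have G: "smooth_map A G" using F smooth_map_cong[of F G] eq by blast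
  have "((\<lambda>x. G (chart_inv c x)) has_derivative
      frechet_derivative (\<lambda>x. F (chart_inv c x)) (at (snd c p))) (at (snd c p))"
    by (rule has_derivative_transform_within_open[OF smooth_map_has_derivative[OF F c]
          open_chart_image[OF c(1)]])
      (use c eq chart_inv_in_points in auto)
  then show ?thesis
    by (simp add: v deriv_along_coord_vec[OF F c] deriv_along_coord_vec[OF G c]
        frechet_derivative_at[symmetric])
qed

lemma deriv_along_const:
  assumes "p \<in> points A" "v \<in> tangent_space A p"
  shows "deriv_along v (\<lambda>q. a :: 'b::euclidean_space) = 0"
proof -
  obtain c w where c: "c \<in> A" "p \<in> fst c" and v: "v = coord_vec A c (snd c p) w"
    using assms by (rule tangent_vectorE)
  show ?thesis
    by (simp add: v deriv_along_coord_vec[OF smooth_map_const c])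
qed

lemma deriv_along_bilinear:
  fixes F :: "'a \<Rightarrow> 'b::euclidean_space" and G :: "'a \<Rightarrow> 'c::euclidean_space"
    and B :: "'b \<Rightarrow> 'c \<Rightarrow> 'd::euclidean_space"
  assumes B: "bounded_bilinear B" and p: "p \<in> points A" "v \<in> tangent_space A p"
    and F: "smooth_map A F" and G: "smooth_map A G"
  shows "deriv_along v (\<lambda>q. B (F q) (G q)) = B (deriv_along v F) (G p) + B (F p) (deriv_along v G)"
proof -
  obtain c w where c: "c \<in> A" "p \<in> fst c" and v: "v = coord_vec A c (snd c p) w"
    using p by (rule tangent_vectorE)
  show ?thesis
    using bounded_bilinear.FDERIV[OF B smooth_map_has_derivative[OF F c]
        smooth_map_has_derivative[OF G c]]
    by (simp add: v deriv_along_coord_vec[OF F c] deriv_along_coord_vec[OF G c]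
        deriv_along_coord_vec[OF smooth_map_bilinear[OF B F G] c] frechet_derivative_at[symmetric]
        chart_inv_chart[OF c])
qed

lemma deriv_along_linear:
  fixes F :: "'a \<Rightarrow> 'b::euclidean_space" and L :: "'b \<Rightarrow> 'd::euclidean_space"
  assumes L: "bounded_linear L" and p: "p \<in> points A" "v \<in> tangent_space A p" and F: "smooth_map A F"
  shows "deriv_along v (\<lambda>q. L (F q)) = L (deriv_along v F)"
proof -
  obtain c w where c: "c \<in> A" "p \<in> fst c" and v: "v = coord_vec A c (snd c p) w"
    using p by (rule tangent_vectorE)
  show ?thesis
    using bounded_linear.has_derivative[OF L smooth_map_has_derivative[OF F c]]
    by (simp add: v deriv_along_coord_vec[OF F c]
        deriv_along_coord_vec[OF smooth_map_linear[OF L F] c] frechet_derivative_at[symmetric])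
qed

section \<open>Cut-offs and global vector fields\<close>

lemma chart_bump:
  assumes "c \<in> A" "p \<in> fst c"
  obtains \<beta> r where "cball (snd c p) r \<subseteq> snd c ` fst c" "smooth_on UNIV \<beta>" "\<beta> (snd c p) \<noteq> (0::real)"
    "\<And>x. x \<notin> cball (snd c p) r \<Longrightarrow> \<beta> x = 0"
proof -
  obtain r where "r > 0" "cball (snd c p) r \<subseteq> snd c ` fst c"
    using open_chart_image[OF assms(1)] assms(2) by (metis imageI open_contains_cball)
  then show ?thesis using bump_function[of r "snd c p"] that by metis
qed

text \<open>Coordinates are not globally defined, so the coordinates centred at \<open>?x\<close>
  are multiplied by a cut-off. The derivative of the cut-off drops out because the coordinate factor
  vanishes at the centre, which leaves \<open>\<beta> ?x *\<^sub>R w\<close>.\<close>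

lemma inj_coord_vec:
  assumes "c \<in> A" "p \<in> fst c"
  shows "inj (coord_vec A c (snd c p))"
proof (rule injI)
  fix w w' assume eq: "coord_vec A c (snd c p) w = coord_vec A c (snd c p) w'"
  let ?x = "snd c p"
  obtain \<beta> r where \<beta>: "cball ?x r \<subseteq> snd c ` fst c" "smooth_on UNIV \<beta>" "\<beta> ?x \<noteq> (0::real)"
    "\<And>x. x \<notin> cball ?x r \<Longrightarrow> \<beta> x = 0"
    using chart_bump[OF assms] by metis
  let ?F = "\<lambda>q. if q \<in> fst c then \<beta> (snd c q) *\<^sub>R (snd c q - ?x) else 0"
  have "smooth_on (snd c ` fst c) (\<lambda>x. x - ?x)"
    by (intro smooth_on_diff smooth_on_const smooth_on_linear bounded_linear_ident
        open_chart_image[OF assms(1)])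
  then have F: "smooth_map A ?F"
    by (rule smooth_map_cutoff[OF assms(1) \<beta>(1,2), rotated]) (rule \<beta>(4))
  have "(\<beta> has_derivative frechet_derivative \<beta> (at ?x)) (at ?x)"
    by (rule smooth_on_has_derivative[OF \<beta>(2)]) simp
  then have "((\<lambda>x. \<beta> x *\<^sub>R (x - ?x)) has_derivative
      (\<lambda>w. \<beta> ?x *\<^sub>R (w - 0) + frechet_derivative \<beta> (at ?x) w *\<^sub>R (?x - ?x))) (at ?x)"
    by (intro derivative_intros)
  then have "((\<lambda>x. \<beta> x *\<^sub>R (x - ?x)) has_derivative (\<lambda>w. \<beta> ?x *\<^sub>R w)) (at ?x)" by simp
  then have "((\<lambda>x. ?F (chart_inv c x)) has_derivative (\<lambda>w. \<beta> ?x *\<^sub>R w)) (at ?x)"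
    by (rule has_derivative_transform_within_open[OF _ open_chart_image[OF assms(1)]])
      (use assms in \<open>auto simp: chart_inv_chart\<close>)
  then have F_deriv: "deriv_along (coord_vec A c ?x w) ?F = \<beta> ?x *\<^sub>R w" for w
    unfolding deriv_along_coord_vec[OF F assms] by (simp add: frechet_derivative_at[symmetric])
  have "\<beta> ?x *\<^sub>R w = \<beta> ?x *\<^sub>R w'"
    unfolding F_deriv[symmetric] eq ..
  then show "w = w'" using \<beta>(3) by simp
qed

lemma vector_field_at: "X \<in> vector_fields A \<Longrightarrow> p \<in> points A \<Longrightarrow> X p \<in> tangent_space A p"
  by (simp add: vector_fields_def)

lemma smooth_map_deriv_along:
  fixes F :: "'a \<Rightarrow> 'b::euclidean_space"
  assumes X: "X \<in> vector_fields A" and F: "smooth_map A F"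
  shows "smooth_map A (\<lambda>q. deriv_along (X q) F)"
proof -
  have "smooth_map A (\<lambda>q. X q (\<lambda>q. F q \<bullet> b))" for b
    using X smooth_map_inner[OF F smooth_map_const] by (simp add: vector_fields_def)
  then show ?thesis
    unfolding deriv_along_def by (intro smooth_map_sum smooth_map_scaleR smooth_map_const)
qed

text \<open>The field is the coordinate field with constant coefficients, cut off and divided by the
  value of the cut-off at \<open>p\<close>. It realises a single tangent vector where connections
  expect vector fields.\<close>

lemma vector_field_extension:
  assumes p: "p \<in> points A" "v \<in> tangent_space A p"
  obtains X where "X \<in> vector_fields A" "X p = v"
proof -
  obtain c w where c: "c \<in> A" "p \<in> fst c" and v: "v = coord_vec A c (snd c p) w"
    using p by (rule tangent_vectorE)
  let ?x = "snd c p"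
  obtain \<beta> r where \<beta>: "cball ?x r \<subseteq> snd c ` fst c" "smooth_on UNIV \<beta>" "\<beta> ?x \<noteq> (0::real)"
    "\<And>x. x \<notin> cball ?x r \<Longrightarrow> \<beta> x = 0"
    using chart_bump[OF c] by metis
  define X where "X = (\<lambda>q. if q \<in> fst c then coord_vec A c (snd c q) ((\<beta> (snd c q) / \<beta> ?x) *\<^sub>R w) else (\<lambda>h. 0))"
  have zero: "(\<lambda>h. 0) \<in> tangent_space A q" if q: "q \<in> points A" for q
  proof -
    obtain d where "d \<in> A" "q \<in> fst d" using q by (rule pointsE)
    then have "coord_vec A d (snd d q) 0 \<in> tangent_space A q"
      by (simp add: tangent_space_eq_range)
    from tangent_space_lincomb[OF q this this, of 0 0] show ?thesis by simp
  qed
  have "X q \<in> tangent_space A q" if "q \<in> points A" for q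
    using zero[OF that] by (auto simp: X_def tangent_space_eq_range[OF c(1)])
  moreover have "smooth_map A (\<lambda>q. X q h)" if h: "smooth_map A h" for h
  proof -
    let ?D = "\<lambda>x. frechet_derivative (\<lambda>x. h (chart_inv c x)) (at x)"
    have "smooth_on (snd c ` fst c) (\<lambda>x. ?D x ((1 / \<beta> ?x) *\<^sub>R w))"
      by (rule smooth_on_frechet_derivative[OF smooth_mapD[OF h c(1)]])
    then have "smooth_map A (\<lambda>q. if q \<in> fst c then \<beta> (snd c q) *\<^sub>R ?D (snd c q) ((1 / \<beta> ?x) *\<^sub>R w) else 0)"
      by (rule smooth_map_cutoff[OF c(1) \<beta>(1,2), rotated]) (rule \<beta>(4))
    moreover have "X q h = (if q \<in> fst c then \<beta> (snd c q) *\<^sub>R ?D (snd c q) ((1 / \<beta> ?x) *\<^sub>R w) else 0)" for q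
    proof (cases "q \<in> fst c")
      case True
      have "linear (?D (snd c q))"
        by (rule has_derivative_linear[OF smooth_map_has_derivative[OF h c(1) True]])
      from linear_scale[OF this, of "\<beta> (snd c q)" "(1 / \<beta> ?x) *\<^sub>R w"] show ?thesis
        using True h by (simp add: X_def coord_vec_apply)
    qed (simp add: X_def)
    ultimately show ?thesis by simp
  qed
  ultimately have "X \<in> vector_fields A" by (simp add: vector_fields_def)
  moreover have "X p = v" using c \<beta>(3) by (simp add: X_def v)
  ultimately show ?thesis by (rule that)
qed

end

section \<open>Forms, projections and space forms\<close>

definition symmetric_form :: "('b \<Rightarrow> 'b \<Rightarrow> real) \<Rightarrow> bool" where
  "symmetric_form B \<longleftrightarrow> (\<forall>x y. B x y = B y x)"

text \<open>The ambient form is indefinite once a curvature is negative, so positivity can only be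
  asked for on a subspace.\<close>

definition positive_on :: "('b::zero \<Rightarrow> 'b \<Rightarrow> real) \<Rightarrow> 'b set \<Rightarrow> bool" where
  "positive_on B W \<longleftrightarrow> (\<forall>x\<in>W. x \<noteq> 0 \<longrightarrow> B x x > 0)"

text \<open>Positivity is applied only to the difference of two candidates, which lies in
  \<open>W\<close>; \<open>x\<close> may be any ambient vector.\<close>

lemma orth_proj_eqI:
  fixes B :: "'b::real_normed_vector \<Rightarrow> 'b \<Rightarrow> real"
  assumes B: "bounded_bilinear B" and W: "subspace W" "positive_on B W"
    and y: "y \<in> W" "\<And>z. z \<in> W \<Longrightarrow> B (x - y) z = 0"
  shows "orth_proj B W x = y"
  unfolding orth_proj_def
proof (rule the_equality)
  show "y \<in> W \<and> (\<forall>z\<in>W. B (x - y) z = 0)" using y by blast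
  fix y' assume y': "y' \<in> W \<and> (\<forall>z\<in>W. B (x - y') z = 0)"
  then have mem: "y' - y \<in> W" using W(1) y(1) by (simp add: subspace_diff)
  have "B (y' - y) (y' - y) = B (x - y) (y' - y) - B (x - y') (y' - y)"
    by (simp add: bounded_bilinear.diff_left[OF B])
  also have "\<dots> = 0" using mem y y' by simp
  finally show "y' = y" using W(2) mem unfolding positive_on_def by force
qed

text \<open>The projection onto the span as a rational formula in the entries, so that its
  dependence on parameters can be followed. The vectors \<open>a'\<close> are orthogonal but not
  normalised. If \<open>a'\<close> is 0, its term is 0 as well.\<close>

fun gram_schmidt :: "('b::real_vector \<Rightarrow> 'b \<Rightarrow> real) \<Rightarrow> 'b list \<Rightarrow> 'b \<Rightarrow> 'b" where
  "gram_schmidt B [] y = 0"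
| "gram_schmidt B (a # as) y = (let a' = a - gram_schmidt B as a in
     gram_schmidt B as y + (B y a' / B a' a') *\<^sub>R a')"

lemma gram_schmidt_in_span: "gram_schmidt B as y \<in> span (set as)"
proof (induction as arbitrary: y)
  case (Cons a as)
  have "gram_schmidt B as z \<in> span (set (a # as))" for z
    using Cons span_mono[of "set as" "set (a # as)"] by auto
  moreover have "a \<in> span (set (a # as))" by (simp add: span_base)
  ultimately show ?case by (simp add: Let_def span_add span_diff span_scale)
qed simp

text \<open>The span of \<open>a # as\<close> is spanned by \<open>as\<close> and by
  \<open>a'\<close>, which is orthogonal to \<open>as\<close>. Adding a multiple of
  \<open>a'\<close> preserves the orthogonality to \<open>as\<close>, and the coefficient is the one
  that gives orthogonality to \<open>a'\<close>.\<close>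

lemma gram_schmidt_orthogonal:
  fixes B :: "'b::real_normed_vector \<Rightarrow> 'b \<Rightarrow> real"
  assumes B: "bounded_bilinear B" "symmetric_form B"
    and pos: "positive_on B (span (set as))" and z: "z \<in> span (set as)"
  shows "B (y - gram_schmidt B as y) z = 0"
  using pos z
proof (induction as arbitrary: y z)
  case Nil
  then show ?case by (simp add: bounded_bilinear.zero_right[OF B(1)])
next
  case (Cons a as)
  interpret B: bounded_bilinear B by (rule B)
  let ?P = "gram_schmidt B as"
  define a' where "a' = a - ?P a"
  have sub: "span (set as) \<subseteq> span (set (a # as))" by (rule span_mono) auto
  then have "positive_on B (span (set as))" using Cons.prems(1) by (auto simp: positive_on_def)
  note IH = Cons.IH[OF this]
  have a'W: "a' \<in> span (set (a # as))"
    unfolding a'_def using gram_schmidt_in_span[of B as a] sub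
    by (intro span_diff) (auto simp: span_base)
  have scal: "B (y - gram_schmidt B (a # as) y) w = B (y - ?P y) w - B y a' / B a' a' * B a' w" for w
    by (simp add: Let_def a'_def[symmetric] B.diff_left B.add_left B.scaleR_left)
  obtain k where k: "z - k *\<^sub>R a \<in> span (set as)"
    using Cons.prems(2) by (auto simp: span_breakdown_eq)
  define z' where "z' = z - k *\<^sub>R a'"
  have "z' = (z - k *\<^sub>R a) + k *\<^sub>R ?P a" by (simp add: z'_def a'_def algebra_simps)
  then have z': "z' \<in> span (set as)"
    using k gram_schmidt_in_span[of B as a] by (simp add: span_add span_scale)
  have "B (y - gram_schmidt B (a # as) y) z' = 0"
    unfolding scal using IH[OF z'] by (simp add: a'_def)
  moreover have "B (y - gram_schmidt B (a # as) y) a' = 0"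
  proof -
    have "B (?P y) a' = 0"
      using IH[OF gram_schmidt_in_span[of B as y], of a] B(2) by (simp add: symmetric_form_def a'_def)
    moreover have "a' = 0 \<or> B a' a' \<noteq> 0"
      using Cons.prems(1) a'W by (force simp: positive_on_def)
    ultimately show ?thesis unfolding scal by (auto simp: B.diff_left B.zero_right)
  qed
  moreover have "z = z' + k *\<^sub>R a'" by (simp add: z'_def)
  ultimately show ?case by (simp add: B.add_right B.scaleR_right)
qed

lemma orth_proj_span:
  fixes B :: "'b::real_normed_vector \<Rightarrow> 'b \<Rightarrow> real"
  assumes "bounded_bilinear B" "symmetric_form B" "positive_on B (span (set as))"
  shows "orth_proj B (span (set as)) y = gram_schmidt B as y"
  by (rule orth_proj_eqI[OF assms(1) subspace_span assms(3) gram_schmidt_in_span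
        gram_schmidt_orthogonal[OF assms]])

lemma subspace_eq_span_list:
  fixes W :: "'b::euclidean_space set"
  assumes "subspace W" obtains as where "W = span (set as)"
  using basis_exists[of W] assms finite_list span_minimal
  by (metis independent_bound_general subset_antisym)

lemma
  fixes B :: "'b::euclidean_space \<Rightarrow> 'b \<Rightarrow> real"
  assumes B: "bounded_bilinear B" "symmetric_form B" and W: "subspace W" "positive_on B W"
  shows orth_proj_in: "orth_proj B W x \<in> W"
    and orth_proj_orthogonal: "z \<in> W \<Longrightarrow> B (x - orth_proj B W x) z = 0"
proof -
  obtain as where as: "W = span (set as)" using subspace_eq_span_list[OF W(1)] .
  show "orth_proj B W x \<in> W"
    using orth_proj_span[OF B] W(2) gram_schmidt_in_span unfolding as by metis
  show "z \<in> W \<Longrightarrow> B (x - orth_proj B W x) z = 0"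
    using orth_proj_span[OF B] W(2) gram_schmidt_orthogonal[OF B] unfolding as by metis
qed

text \<open>Independence at every point keeps the denominators \<open>B (a x) (a x)\<close> nonzero.
  The formula would still project for dependent vectors, but need not do so smoothly.\<close>

lemma smooth_on_gram_schmidt:
  fixes e :: "'i \<Rightarrow> 'e::real_normed_vector \<Rightarrow> 'b::euclidean_space"
  assumes S: "open S" and B: "bounded_bilinear B"
    and e: "\<And>i. i \<in> set xs \<Longrightarrow> smooth_on S (e i)" and F: "smooth_on S F" and "distinct xs"
    and "\<And>x. x \<in> S \<Longrightarrow> positive_on B (span ((\<lambda>i. e i x) ` set xs))"
    and "\<And>x. x \<in> S \<Longrightarrow> inj_on (\<lambda>i. e i x) (set xs) \<and> independent ((\<lambda>i. e i x) ` set xs)"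
  shows "smooth_on S (\<lambda>x. gram_schmidt B (map (\<lambda>i. e i x) xs) (F x))"
  using assms(3-)
proof (induction xs arbitrary: F)
  case Nil
  then show ?case by (simp add: smooth_on_const)
next
  case (Cons i xs)
  let ?P = "\<lambda>x. gram_schmidt B (map (\<lambda>i. e i x) xs)"
  have IH: "smooth_on S (\<lambda>x. ?P x (G x))" if G: "smooth_on S G" for G
  proof (rule Cons.IH[OF _ G])
    fix x assume x: "x \<in> S"
    have "span ((\<lambda>i. e i x) ` set xs) \<subseteq> span ((\<lambda>i. e i x) ` set (i # xs))"
      by (rule span_mono) auto
    then show "positive_on B (span ((\<lambda>i. e i x) ` set xs))"
      using Cons.prems(4)[OF x] by (auto simp: positive_on_def)
    show "inj_on (\<lambda>i. e i x) (set xs) \<and> independent ((\<lambda>i. e i x) ` set xs)"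
      using Cons.prems(5)[OF x] independent_mono[of "(\<lambda>i. e i x) ` set (i # xs)"] by auto
  qed (use Cons.prems in auto)
  define a where "a = (\<lambda>x. e i x - ?P x (e i x))"
  have a: "smooth_on S a"
    unfolding a_def using Cons.prems(1) IH by (intro smooth_on_diff S) auto
  have "B (a x) (a x) \<noteq> 0" if x: "x \<in> S" for x
  proof -
    have "e i x \<notin> span ((\<lambda>i. e i x) ` set xs)"
    proof -
      have "e i x \<notin> (\<lambda>i. e i x) ` set xs"
        using Cons.prems(3) Cons.prems(5)[OF x] by auto
      then show ?thesis using Cons.prems(5)[OF x] by (simp add: independent_insert)
    qed
    moreover have P: "?P x (e i x) \<in> span ((\<lambda>i. e i x) ` set xs)"
      using gram_schmidt_in_span[of B "map (\<lambda>i. e i x) xs"] by simp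
    ultimately have "a x \<noteq> 0" by (auto simp: a_def)
    moreover have "a x \<in> span ((\<lambda>i. e i x) ` set (i # xs))"
      unfolding a_def using P span_mono[of "(\<lambda>i. e i x) ` set xs" "(\<lambda>i. e i x) ` set (i # xs)"]
      by (intro span_diff) (auto simp: span_base)
    ultimately show ?thesis using Cons.prems(4)[OF x] by (force simp: positive_on_def)
  qed
  then have "smooth_on S (\<lambda>x. ?P x (F x) + (B (F x) (a x) / B (a x) (a x)) *\<^sub>R a x)"
    using Cons.prems(2) a
    by (intro smooth_on_add smooth_on_scaleR smooth_on_divide smooth_on_bilinear[OF B] IH S)
  then show ?case by (simp add: Let_def a_def)
qed

text \<open>While fewer than \<open>CARD('m)\<close> indices are used, a dimension count leaves a
  vector outside the span; its orthogonal remainder, normalised, becomes the next member.\<close>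

lemma orthonormal_family_exists:
  fixes G :: "real ^ 'm::finite \<Rightarrow> real ^ 'm \<Rightarrow> real"
  assumes G: "bounded_bilinear G" "symmetric_form G" "positive_on G UNIV"
  shows "\<exists>e. \<forall>i j. G (e i) (e j) = (if i = (j::'m) then 1 else 0)"
proof -
  interpret G: bounded_bilinear G by (rule G)
  have "\<exists>e. \<forall>i\<in>I. \<forall>j\<in>I. G (e i) (e j) = (if i = (j::'m) then 1 else 0)" if "finite I" for I
    using that
  proof (induction I rule: finite_induct)
    case (insert k I)
    then obtain e where e: "\<And>i j. i \<in> I \<Longrightarrow> j \<in> I \<Longrightarrow> G (e i) (e j) = (if i = j then 1 else 0)"
      by blast
    have "dim (span (e ` I)) \<le> card I"
      using insert.hyps(1) dim_le_card'[of "e ` I"] card_image_le[of I e] by (simp add: dim_span)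
    also have "card I < CARD('m)"
      using insert.hyps by (metis UNIV_I card_mono finite_class.finite_UNIV card_insert_disjoint
        subset_UNIV Suc_le_eq)
    finally have "span (e ` I) \<noteq> (UNIV :: (real ^ 'm) set)"
      by (metis dim_UNIV DIM_cart DIM_real mult.right_neutral less_irrefl)
    then obtain w where w: "w \<notin> span (e ` I)" by blast
    define u where "u = w - (\<Sum>i\<in>I. G w (e i) *\<^sub>R e i)"
    have "(\<Sum>i\<in>I. G w (e i) *\<^sub>R e i) \<in> span (e ` I)"
      by (intro span_sum span_scale span_base) auto
    then have "u \<noteq> 0" unfolding u_def using w by (metis eq_iff_diff_eq_0)
    then have pos: "G u u > 0" using G(3) by (simp add: positive_on_def)
    have orth: "G u (e j) = 0" if "j \<in> I" for j
      using that insert.hyps(1)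
      by (simp add: u_def G.diff_left G.sum_left G.scaleR_left e if_distrib[of "(*) _"] cong: if_cong)
    then have orth': "G (e j) u = 0" if "j \<in> I" for j
      using that G(2) by (simp add: symmetric_form_def)
    define e' where "e' = (\<lambda>i. if i = k then (1 / sqrt (G u u)) *\<^sub>R u else e i)"
    have "\<forall>i\<in>insert k I. \<forall>j\<in>insert k I. G (e' i) (e' j) = (if i = j then 1 else 0)"
      using pos orth orth' e insert.hyps(2)
      by (auto simp: e'_def G.scaleR_left G.scaleR_right)
    then show ?case by blast
  qed simp
  from this[of UNIV] show ?thesis by simp
qed

text \<open>Orthonormality forces independence, and the index type \<open>'m\<close> supplies as
  many members as the dimension, so the family spans.\<close>

lemma orthonormal_family_expansion:
  fixes G :: "real ^ 'm::finite \<Rightarrow> real ^ 'm \<Rightarrow> real"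
  assumes G: "bounded_bilinear G"
    and e: "\<And>i j. G (e i) (e j) = (if i = (j::'m) then 1 else 0)"
  shows "w = (\<Sum>i\<in>UNIV. G w (e i) *\<^sub>R e i)"
proof -
  interpret G: bounded_bilinear G by (rule G)
  have coeff: "G (\<Sum>i\<in>UNIV. c i *\<^sub>R e i) (e j) = c j" for c j
    by (simp add: G.sum_left G.scaleR_left e if_distrib[of "(*) _"] cong: if_cong)
  have inj: "inj e"
    by (rule injI) (metis e zero_neq_one)
  have "independent (range e)"
    unfolding independent_explicit
  proof (intro conjI allI impI)
    fix c assume "(\<Sum>v\<in>range e. c v *\<^sub>R v) = 0"
    then have "(\<Sum>i\<in>UNIV. c (e i) *\<^sub>R e i) = 0" by (simp add: sum.reindex[OF inj])
    then show "\<forall>v\<in>range e. c v = 0" using coeff[of "\<lambda>i. c (e i)"] by (auto simp: G.zero_left)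
  qed simp
  then have "span (range e) = UNIV"
    using card_eq_dim[of "range e" UNIV] card_image[OF inj] by (simp add: dim_UNIV top.extremum_unique)
  then have "w \<in> span (range e)" by simp
  then obtain c where "w = (\<Sum>v\<in>range e. c v *\<^sub>R v)"
    by (auto simp: span_finite)
  then have "w = (\<Sum>i\<in>UNIV. c (e i) *\<^sub>R e i)" by (simp add: sum.reindex[OF inj])
  then show ?thesis using coeff[of "\<lambda>i. c (e i)"] by simp
qed

section \<open>The ambient forms and the space forms\<close>

lemma bounded_bilinear_flat_form: "bounded_bilinear (flat_form k :: 'n::finite ambient \<Rightarrow> _)"
proof (cases "k < 0")
  case True
  have "bilinear (flat_form k :: 'n ambient \<Rightarrow> _)"
    unfolding bilinear_def by (auto intro!: linearI simp: flat_form_def True algebra_simps inner_simps)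
  then show ?thesis by (simp add: bilinear_conv_bounded_bilinear)
next
  case False
  have "bilinear (flat_form k :: 'n ambient \<Rightarrow> _)"
    unfolding bilinear_def by (auto intro!: linearI simp: flat_form_def False algebra_simps inner_simps)
  then show ?thesis by (simp add: bilinear_conv_bounded_bilinear)
qed

lemma flat_form_commute: "flat_form k x y = flat_form k y x"
  by (simp add: flat_form_def mult.commute inner_commute)

lemma bounded_bilinear_prod_form:
  "bounded_bilinear (prod_form k1 k2 :: ('n1::finite, 'n2::finite) prod_ambient \<Rightarrow> _)"
proof -
  interpret B1: bounded_bilinear "flat_form k1 :: 'n1 ambient \<Rightarrow> _" by (rule bounded_bilinear_flat_form)
  interpret B2: bounded_bilinear "flat_form k2 :: 'n2 ambient \<Rightarrow> _" by (rule bounded_bilinear_flat_form)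
  have "bilinear (prod_form k1 k2 :: ('n1, 'n2) prod_ambient \<Rightarrow> _)"
    unfolding bilinear_def
    by (intro conjI allI linearI; simp add: prod_form_def B1.add_left B1.add_right B1.scaleR_left B1.scaleR_right
        B2.add_left B2.add_right B2.scaleR_left B2.scaleR_right algebra_simps)
  then show ?thesis by (simp add: bilinear_conv_bounded_bilinear)
qed

lemma symmetric_form_prod_form: "symmetric_form (prod_form k1 k2)"
  by (simp add: symmetric_form_def prod_form_def flat_form_commute)

text \<open>For \<open>k < 0\<close> the point \<open>X\<close> is timelike, and a vector orthogonal
  to a timelike one is spacelike: the Cauchy-Schwarz inequality for the spatial parts, combined with
  \<open>|snd X| < fst X\<close>, bounds \<open>fst v\<close> strictly by the length of
  \<open>snd v\<close>.\<close>

lemma flat_form_positive: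
  assumes "X \<in> space_form k" "v \<in> space_form_tangent k X" "v \<noteq> 0"
  shows "flat_form k v v > 0"
proof (cases "k < 0")
  case False
  have "flat_form k v v = v \<bullet> v" using False by (simp add: flat_form_def inner_prod_def)
  then show ?thesis using assms(3) by simp
next
  case True
  then have X: "(snd X \<bullet> snd X) - (fst X)\<^sup>2 < 0" and pos: "fst X > 0"
    and v: "fst X * fst v = snd X \<bullet> snd v"
    using assms(1,2) by (auto simp: space_form_def space_form_tangent_def flat_form_def power2_eq_square)
  \<comment> \<open>This makes the last inequality of the chain below strict.\<close>
  have "snd v \<noteq> 0"
  proof
    assume "snd v = 0"
    then have "v = 0" using v pos by (simp add: prod_eq_iff)
    then show False using assms(3) by simp
  qed
  then have vv: "snd v \<bullet> snd v > 0" by simp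
  have "(fst X)\<^sup>2 * (fst v)\<^sup>2 = (snd X \<bullet> snd v)\<^sup>2"
    using v by (metis power_mult_distrib)
  also have "\<dots> \<le> (snd X \<bullet> snd X) * (snd v \<bullet> snd v)" by (rule Cauchy_Schwarz_ineq)
  also have "\<dots> < (fst X)\<^sup>2 * (snd v \<bullet> snd v)" using X vv by simp
  finally have "(fst v)\<^sup>2 < snd v \<bullet> snd v" using pos by simp
  then show ?thesis using True by (simp add: flat_form_def power2_eq_square)
qed

text \<open>A vector field normal to the space form in the ambient flat space; its flat length squared is
  the inverse of the factor defined next.\<close>

definition conormal :: "real \<Rightarrow> 'n::finite ambient \<Rightarrow> 'n ambient" where
  "conormal k X = (if k = 0 then (1, 0) else X)"

definition conormal_factor :: "real \<Rightarrow> real" where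
  "conormal_factor k = (if k = 0 then 1 else k)"

lemma conormal_normalized:
  "X \<in> space_form k \<Longrightarrow> conormal_factor k * flat_form k (conormal k X) (conormal k X) = 1"
  by (auto simp: conormal_def conormal_factor_def space_form_def flat_form_def split: if_splits)

text \<open>For \<open>k = 0\<close> the conormal is the first unit vector and its pairing with
  \<open>v\<close> is \<open>fst v\<close>, so flat and curved factors share one equation.\<close>

lemma space_form_tangent_iff:
  "v \<in> space_form_tangent k X \<longleftrightarrow> flat_form k (conormal k X) v = 0"
  by (simp add: space_form_tangent_def conormal_def flat_form_def)

text \<open>The tangential projection as a closed formula, visibly smooth in the base point, which
  the description in \<open>orth_proj\<close> is not.\<close>

definition space_form_proj :: "real \<Rightarrow> 'n::finite ambient \<Rightarrow> 'n ambient \<Rightarrow> 'n ambient" where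
  "space_form_proj k X y =
    y - (conormal_factor k * flat_form k (conormal k X) y) *\<^sub>R conormal k X"

lemma space_form_proj_in:
  fixes X :: "'n::finite ambient"
  assumes "X \<in> space_form k" shows "space_form_proj k X y \<in> space_form_tangent k X"
proof -
  interpret B: bounded_bilinear "flat_form k :: 'n ambient \<Rightarrow> _" by (rule bounded_bilinear_flat_form)
  show ?thesis
    using conormal_normalized[OF assms]
    by (simp add: space_form_tangent_iff space_form_proj_def B.diff_right B.scaleR_right
        flip: mult.assoc)
qed

lemma space_form_proj_orthogonal:
  fixes X :: "'n::finite ambient"
  assumes "z \<in> space_form_tangent k X" shows "flat_form k (y - space_form_proj k X y) z = 0"
proof -
  interpret B: bounded_bilinear "flat_form k :: 'n ambient \<Rightarrow> _" by (rule bounded_bilinear_flat_form)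
  show ?thesis
    using assms by (simp add: space_form_tangent_iff space_form_proj_def B.scaleR_left)
qed

lemma subspace_space_form_tangent: "subspace (space_form_tangent k X)"
proof -
  interpret B: bounded_bilinear "flat_form k" by (rule bounded_bilinear_flat_form)
  show ?thesis
    by (auto simp: subspace_def space_form_tangent_iff B.zero_right B.add_right B.scaleR_right)
qed

lemma subspace_prod_tangent: "subspace (prod_tangent k1 k2 X)"
  unfolding prod_tangent_def by (intro subspace_Times subspace_space_form_tangent)

lemma positive_on_prod_tangent:
  assumes "X \<in> space_form k1 \<times> space_form k2"
  shows "positive_on (prod_form k1 k2) (prod_tangent k1 k2 X)"
  unfolding positive_on_def
proof (intro ballI impI)
  fix v assume v: "v \<in> prod_tangent k1 k2 X" "v \<noteq> 0"
  have nonneg: "flat_form k w w \<ge> 0" if "Y \<in> space_form k" "w \<in> space_form_tangent k Y"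
    for k and Y w :: "'n::finite ambient"
  proof (cases "w = 0")
    case False
    then show ?thesis using flat_form_positive[OF that] by simp
  qed (simp add: flat_form_def)
  have "flat_form k1 (fst v) (fst v) \<ge> 0" "flat_form k2 (snd v) (snd v) \<ge> 0"
    using nonneg assms v(1) by (auto simp: prod_tangent_def)
  moreover have "flat_form k1 (fst v) (fst v) > 0 \<or> flat_form k2 (snd v) (snd v) > 0"
    using flat_form_positive[of "fst X" k1 "fst v"] flat_form_positive[of "snd X" k2 "snd v"] assms v
    by (auto simp: prod_tangent_def prod_eq_iff)
  ultimately show "prod_form k1 k2 v v > 0"
    unfolding prod_form_def by linarith
qed

lemma orth_proj_prod_tangent:
  assumes "X \<in> space_form k1 \<times> space_form k2"
  shows "orth_proj (prod_form k1 k2) (prod_tangent k1 k2 X) y =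
    (space_form_proj k1 (fst X) (fst y), space_form_proj k2 (snd X) (snd y))"
  using assms
  by (intro orth_proj_eqI[OF bounded_bilinear_prod_form subspace_prod_tangent positive_on_prod_tangent])
    (auto simp: prod_tangent_def prod_form_def space_form_proj_in space_form_proj_orthogonal)

section \<open>Immersions into products of space forms\<close>

lemma smooth_on_Pair:
  fixes f :: "'e::real_normed_vector \<Rightarrow> 'b::euclidean_space" and g :: "'e \<Rightarrow> 'c::euclidean_space"
  assumes "open S" "smooth_on S f" "smooth_on S g"
  shows "smooth_on S (\<lambda>x. (f x, g x))"
proof -
  have "bounded_linear (\<lambda>y::'b. (y, 0::'c))" "bounded_linear (\<lambda>y::'c. (0::'b, y))"
    by (auto intro!: bounded_linear_Pair bounded_linear_ident bounded_linear_zero)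
  then have "smooth_on S (\<lambda>x. (f x, 0::'c) + (0::'b, g x))"
    using smooth_on_linear_compose[OF assms(1) _ assms(2)] smooth_on_linear_compose[OF assms(1) _ assms(3)]
    by (intro smooth_on_add assms(1)) blast+
  then show ?thesis by simp
qed

lemma smooth_on_space_form_proj:
  fixes F G :: "'e::real_normed_vector \<Rightarrow> 'n::finite ambient"
  assumes "open S" "smooth_on S F" "smooth_on S G"
  shows "smooth_on S (\<lambda>x. space_form_proj k (F x) (G x))"
proof -
  have N: "smooth_on S (\<lambda>x. conormal k (F x))"
    using assms(2) by (cases "k = 0") (auto simp: conormal_def smooth_on_const)
  show ?thesis
    unfolding space_form_proj_def
    by (intro smooth_on_diff smooth_on_scaleR smooth_on_mult smooth_on_const assms N
        smooth_on_bilinear[OF bounded_bilinear_flat_form])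
qed

lemma deriv_along_sum:
  "deriv_along (\<lambda>h. \<Sum>i\<in>I. a i * u i h) F = (\<Sum>i\<in>I. a i *\<^sub>R deriv_along (u i) F)"
proof -
  have "deriv_along (\<lambda>h. \<Sum>i\<in>I. a i * u i h) F = (\<Sum>b\<in>Basis. \<Sum>i\<in>I. (a i * u i (\<lambda>q. F q \<bullet> b)) *\<^sub>R b)"
    by (simp add: deriv_along_def scaleR_sum_left)
  also have "\<dots> = (\<Sum>i\<in>I. a i *\<^sub>R deriv_along (u i) F)"
    by (subst sum.swap) (simp add: deriv_along_def scaleR_sum_right)
  finally show ?thesis .
qed

text \<open>This is the flatness of the ambient space. Applied to \<open>f\<close> it gives the
  symmetry of the second fundamental form, applied to a normal field the Ricci equation, and applied
  to the image of a vector field under the differential the Codazzi equation.\<close>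

lemma deriv_along_lie_bracket:
  fixes F :: "'a \<Rightarrow> 'b::euclidean_space"
  shows "deriv_along (lie_bracket X Y p) F =
    deriv_along (X p) (\<lambda>q. deriv_along (Y q) F) - deriv_along (Y p) (\<lambda>q. deriv_along (X q) F)"
proof -
  have "deriv_along u F \<bullet> b = u (\<lambda>q. F q \<bullet> b)" if "b \<in> Basis" for u :: "'a tvec" and b :: 'b
    using that by (simp add: deriv_along_def inner_sum_left inner_Basis if_distrib cong: if_cong)
  then have "deriv_along v (\<lambda>q. deriv_along (W q) F) = (\<Sum>b\<in>Basis. v (\<lambda>q. W q (\<lambda>q. F q \<bullet> b)) *\<^sub>R b)"
    for v and W :: "'a \<Rightarrow> 'a tvec"
    unfolding deriv_along_def[of v] by (intro sum.cong) auto
  note this[of "X p" Y] this[of "Y p" X]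
  then show ?thesis
    by (simp add: lie_bracket_def scaleR_diff_left sum_subtractf
        deriv_along_def[of "\<lambda>h. X p (\<lambda>q. Y q h) - Y p (\<lambda>q. X q h)"])
qed

text \<open>The product rule for a constant pairing: it moves a derivative from one factor to the
  other.\<close>

lemma (in manifold) deriv_along_bilinear_zero:
  fixes F :: "'a \<Rightarrow> 'b::euclidean_space" and G :: "'a \<Rightarrow> 'c::euclidean_space"
    and B :: "'b \<Rightarrow> 'c \<Rightarrow> real"
  assumes B: "bounded_bilinear B" and p: "p \<in> points A" "v \<in> tangent_space A p"
    and F: "smooth_map A F" and G: "smooth_map A G"
    and const: "\<And>q. q \<in> points A \<Longrightarrow> B (F q) (G q) = a"
  shows "B (deriv_along v F) (G p) + B (F p) (deriv_along v G) = 0"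
proof -
  have "deriv_along v (\<lambda>q. B (F q) (G q)) = deriv_along v (\<lambda>q. a)"
    by (rule deriv_along_cong[OF p smooth_map_bilinear[OF B F G] const])
  then show ?thesis
    using deriv_along_bilinear[OF B p F G] deriv_along_const[OF p, of a] by simp
qed

lemma (in manifold) deriv_along_space_form:
  fixes F :: "'a \<Rightarrow> 'n::finite ambient"
  assumes p: "p \<in> points A" "v \<in> tangent_space A p" and F: "smooth_map A F"
    and F_in: "\<And>q. q \<in> points A \<Longrightarrow> F q \<in> space_form k"
  shows "deriv_along v F \<in> space_form_tangent k (F p)"
proof (cases "k = 0")
  case True
  have "fst (deriv_along v F) = deriv_along v (\<lambda>q. fst (F q))"
    by (rule deriv_along_linear[OF bounded_linear_fst p F, symmetric])
  also have "\<dots> = deriv_along v (\<lambda>q. 0)"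
    by (rule deriv_along_cong[OF p smooth_map_linear[OF bounded_linear_fst F]])
      (use F_in True in \<open>auto simp: space_form_def\<close>)
  also have "\<dots> = 0" by (rule deriv_along_const[OF p])
  finally show ?thesis using True by (simp add: space_form_tangent_def)
next
  case False
  have "flat_form k (F q) (F q) = 1 / k" if "q \<in> points A" for q
    using F_in[OF that] False by (auto simp: space_form_def split: if_splits)
  from deriv_along_bilinear_zero[OF bounded_bilinear_flat_form p F F this]
  show ?thesis using False by (simp add: space_form_tangent_def flat_form_commute)
qed

text \<open>Differentiating the orthogonality of \<open>u\<close> and the conormal shows that the
  conormal part of the derivative of \<open>u\<close> is governed by the pairing of \<open>u\<close>
  with the derivative of \<open>F\<close>, which \<open>orth\<close> makes 0. For
  \<open>k = 0\<close> the conormal is constant.\<close>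

lemma (in manifold) deriv_along_space_form_tangent:
  fixes F u :: "'a \<Rightarrow> 'n::finite ambient"
  assumes p: "p \<in> points A" "v \<in> tangent_space A p" and F: "smooth_map A F" and u: "smooth_map A u"
    and u_in: "\<And>q. q \<in> points A \<Longrightarrow> u q \<in> space_form_tangent k (F q)"
    and orth: "flat_form k (deriv_along v F) (u p) = 0"
  shows "deriv_along v u \<in> space_form_tangent k (F p)"
proof -
  have N: "smooth_map A (\<lambda>q. conormal k (F q))"
    using F by (cases "k = 0") (auto simp: conormal_def smooth_map_const)
  have "flat_form k (conormal k (F q)) (u q) = 0" if "q \<in> points A" for q
    using u_in[OF that] by (simp add: space_form_tangent_iff)
  from deriv_along_bilinear_zero[OF bounded_bilinear_flat_form p N u this]
  have "flat_form k (deriv_along v (\<lambda>q. conormal k (F q))) (u p)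
    + flat_form k (conormal k (F p)) (deriv_along v u) = 0" .
  moreover have "flat_form k (deriv_along v (\<lambda>q. conormal k (F q))) (u p) = 0"
    using orth by (cases "k = 0") (auto simp: conormal_def deriv_along_const[OF p]
        bounded_bilinear.zero_left[OF bounded_bilinear_flat_form])
  ultimately show ?thesis by (simp add: space_form_tangent_iff)
qed

locale immersion = manifold T A
  for T :: "'a topology" and A :: "('a, 'm::finite) chart set" +
  fixes g :: "'a \<Rightarrow> 'a tvec \<Rightarrow> 'a tvec \<Rightarrow> real"
    and nabla :: "'a vfield \<Rightarrow> 'a vfield \<Rightarrow> 'a vfield"
    and k1 k2 :: real
    and f :: "'a \<Rightarrow> ('n1::finite, 'n2::finite) prod_ambient"
  assumes levi_civita: "levi_civita_connection A g nabla"
    and isometric: "isometric_immersion A g k1 k2 f"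
begin

abbreviation B :: "('n1, 'n2) prod_ambient \<Rightarrow> ('n1, 'n2) prod_ambient \<Rightarrow> real"
  where "B \<equiv> prod_form k1 k2"
abbreviation N :: "'a \<Rightarrow> ('n1, 'n2) prod_ambient set" where "N \<equiv> normal_space A k1 k2 f"
abbreviation nor :: "'a \<Rightarrow> ('n1, 'n2) prod_ambient \<Rightarrow> ('n1, 'n2) prod_ambient"
  where "nor \<equiv> normal_part A k1 k2 f"
abbreviation D_perp where "D_perp \<equiv> normal_connection A k1 k2 f"
abbreviation R_perp where "R_perp \<equiv> normal_curvature A k1 k2 f"
abbreviation \<alpha> where "\<alpha> \<equiv> second_fundamental_form_at A k1 k2 f"
abbreviation L where "L \<equiv> kernel_perp A k1 k2 f"

sublocale B: bounded_bilinear B by (rule bounded_bilinear_prod_form)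

lemma B_commute: "B x y = B y x"
  by (simp add: prod_form_def flat_form_commute)

lemma smooth_f: "smooth_map A f"
  using isometric by (simp add: isometric_immersion_def)

lemma f_in_product: "p \<in> points A \<Longrightarrow> f p \<in> space_form k1 \<times> space_form k2"
  using isometric by (simp add: isometric_immersion_def)

lemma inj_on_differential: "p \<in> points A \<Longrightarrow> inj_on (\<lambda>v. deriv_along v f) (tangent_space A p)"
  using isometric by (simp add: isometric_immersion_def)

lemma metric_eq: "p \<in> points A \<Longrightarrow> v \<in> tangent_space A p \<Longrightarrow> w \<in> tangent_space A p \<Longrightarrow>
    g p v w = B (deriv_along v f) (deriv_along w f)"
  using isometric by (simp add: isometric_immersion_def)

lemma differential_in_prod_tangent:
  assumes p: "p \<in> points A" "v \<in> tangent_space A p"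
  shows "deriv_along v f \<in> prod_tangent k1 k2 (f p)"
proof -
  have "deriv_along v (\<lambda>q. fst (f q)) \<in> space_form_tangent k1 (fst (f p))"
    by (rule deriv_along_space_form[OF p smooth_map_linear[OF bounded_linear_fst smooth_f]])
      (use f_in_product in force)
  moreover have "deriv_along v (\<lambda>q. snd (f q)) \<in> space_form_tangent k2 (snd (f p))"
    by (rule deriv_along_space_form[OF p smooth_map_linear[OF bounded_linear_snd smooth_f]])
      (use f_in_product in force)
  ultimately show ?thesis
    by (simp add: prod_tangent_def mem_Times_iff deriv_along_linear[OF bounded_linear_fst p smooth_f]
        deriv_along_linear[OF bounded_linear_snd p smooth_f])
qed

section \<open>The normal projection\<close>

lemma N_subset: "N p \<subseteq> prod_tangent k1 k2 (f p)"
  by (auto simp: normal_space_def)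

lemma N_orthogonal: "\<zeta> \<in> N p \<Longrightarrow> v \<in> tangent_space A p \<Longrightarrow> B \<zeta> (deriv_along v f) = 0"
  by (simp add: normal_space_def)

lemma subspace_N: "subspace (N p)"
  using subspace_prod_tangent[of k1 k2 "f p"]
  by (auto simp: subspace_def normal_space_def B.zero_left B.add_left B.scaleR_left)

lemma positive_on_PT: "p \<in> points A \<Longrightarrow> positive_on B (prod_tangent k1 k2 (f p))"
  by (rule positive_on_prod_tangent[OF f_in_product])

lemma positive_on_N: "p \<in> points A \<Longrightarrow> positive_on B (N p)"
  using positive_on_PT N_subset by (force simp: positive_on_def)

lemma nor_eqI:
  assumes "p \<in> points A" "y \<in> N p" "\<And>z. z \<in> N p \<Longrightarrow> B (x - y) z = 0"
  shows "nor p x = y"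
  unfolding normal_part_def
  using orth_proj_eqI[OF bounded_bilinear_prod_form subspace_N positive_on_N[OF assms(1)]] assms(2,3)
  by blast

lemma nor_in: "p \<in> points A \<Longrightarrow> nor p x \<in> N p"
  unfolding normal_part_def
  by (rule orth_proj_in[OF bounded_bilinear_prod_form symmetric_form_prod_form subspace_N positive_on_N])

lemma B_nor:
  assumes "p \<in> points A" "z \<in> N p"
  shows "B (nor p x) z = B x z"
proof -
  have "B (x - nor p x) z = 0"
    unfolding normal_part_def
    by (rule orth_proj_orthogonal[OF bounded_bilinear_prod_form symmetric_form_prod_form
          subspace_N positive_on_N[OF assms(1)] assms(2)])
  then show ?thesis by (simp add: B.diff_left)
qed

lemma nor_id: "p \<in> points A \<Longrightarrow> x \<in> N p \<Longrightarrow> nor p x = x"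
  by (rule nor_eqI) (auto simp: B.zero_left)

lemma nor_zero: "p \<in> points A \<Longrightarrow> nor p 0 = 0"
  using nor_id subspace_0[OF subspace_N] by blast

lemma nor_add: "p \<in> points A \<Longrightarrow> nor p (x + y) = nor p x + nor p y"
  by (rule nor_eqI) (auto simp: nor_in subspace_add[OF subspace_N] B.diff_left B.add_left B_nor)

lemma nor_diff: "p \<in> points A \<Longrightarrow> nor p (x - y) = nor p x - nor p y"
  by (rule nor_eqI) (auto simp: nor_in subspace_diff[OF subspace_N] B.diff_left B_nor)

lemma nor_scaleR: "p \<in> points A \<Longrightarrow> nor p (a *\<^sub>R x) = a *\<^sub>R nor p x"
  by (rule nor_eqI) (auto simp: nor_in subspace_scale[OF subspace_N] B.diff_left B.scaleR_left B_nor)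

lemma nor_sum: "p \<in> points A \<Longrightarrow> nor p (\<Sum>i\<in>I. x i) = (\<Sum>i\<in>I. nor p (x i))"
  by (induction I rule: infinite_finite_induct) (auto simp: nor_zero nor_add)

lemma nor_differential: "p \<in> points A \<Longrightarrow> v \<in> tangent_space A p \<Longrightarrow> nor p (deriv_along v f) = 0"
  using N_orthogonal by (intro nor_eqI) (auto simp: subspace_0[OF subspace_N] B_commute)

text \<open>The normal space lies in the tangent space of the product, so projecting first onto the
  latter changes nothing. From here on the normal connection is the normal part of the flat
  derivative.\<close>

lemma nor_ambient_connection:
  assumes p: "p \<in> points A"
  shows "nor p (ambient_connection k1 k2 f p v F) = nor p (deriv_along v F)"
proof (rule nor_eqI[OF p nor_in[OF p]])
  fix z assume z: "z \<in> N p"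
  have "B (deriv_along v F - ambient_connection k1 k2 f p v F) z = 0"
    unfolding ambient_connection_def
    by (rule orth_proj_orthogonal[OF bounded_bilinear_prod_form symmetric_form_prod_form
          subspace_prod_tangent positive_on_PT[OF p]])
      (use z N_subset in blast)
  then show "B (ambient_connection k1 k2 f p v F - nor p (deriv_along v F)) z = 0"
    by (simp add: B.diff_left B_nor[OF p z])
qed

lemma D_perp_eq: "p \<in> points A \<Longrightarrow> D_perp X \<xi> p = nor p (deriv_along (X p) \<xi>)"
  by (simp add: normal_connection_def nor_ambient_connection)

text \<open>In a chart the normal part is a difference of two smooth formulas: the explicit
  projection \<open>P\<close> onto the tangent space of the product, and its Gram-Schmidt projection
  onto the coordinate derivatives of \<open>f\<close>.\<close>

lemma smooth_nor:
  assumes F: "smooth_map A F"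
  shows "smooth_map A (\<lambda>q. nor q (F q))"
proof (rule smooth_mapI)
  fix c assume c: "c \<in> A"
  let ?S = "snd c ` fst c"
  let ?\<phi> = "\<lambda>x. f (chart_inv c x)" and ?F = "\<lambda>x. F (chart_inv c x)"
  note S = open_chart_image[OF c]
  define e where "e = (\<lambda>(i::'m) x. frechet_derivative ?\<phi> (at x) (axis i 1))"
  define P where "P = (\<lambda>x. (space_form_proj k1 (fst (?\<phi> x)) (fst (?F x)),
    space_form_proj k2 (snd (?\<phi> x)) (snd (?F x))))"
  obtain xs where xs: "set xs = (UNIV :: 'm set)" "distinct xs"
    using finite_distinct_list[of "UNIV :: 'm set"] by auto
  note \<phi>_smooth = smooth_mapD[OF smooth_f c] and F_smooth = smooth_mapD[OF F c]
  have P: "smooth_on ?S P"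
    unfolding P_def
    by (intro smooth_on_Pair smooth_on_space_form_proj smooth_on_linear_compose[OF S bounded_linear_fst]
        smooth_on_linear_compose[OF S bounded_linear_snd] S \<phi>_smooth F_smooth)
  \<comment> \<open>The differential of \<open>f\<close> and the chart coefficients are both
    injective, so the coordinate derivatives form a basis of the image of the tangent space, as
    Gram-Schmidt demands for smoothness.\<close>
  have frame: "span ((\<lambda>i. e i x) ` set xs) = (\<lambda>v. deriv_along v f) ` tangent_space A (chart_inv c x)"
    "inj_on (\<lambda>i. e i x) (set xs) \<and> independent ((\<lambda>i. e i x) ` set xs)"
    if x: "x \<in> ?S" for x
  proof -
    let ?q = "chart_inv c x" and ?D = "frechet_derivative ?\<phi> (at x)"
    have q: "?q \<in> fst c" "snd c ?q = x" using x by (auto simp: chart_inv_chart[OF c])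
    then have qp: "?q \<in> points A" using chart_subset_points[OF c] by blast
    have lin: "linear ?D"
      using smooth_map_has_derivative[OF smooth_f c q(1)] q(2) by (simp add: has_derivative_linear)
    have D: "?D w = deriv_along (coord_vec A c x w) f" for w
      using deriv_along_coord_vec[OF smooth_f c q(1)] q(2) by simp
    have tan: "tangent_space A ?q = range (coord_vec A c x)"
      using tangent_space_eq_range[OF c q(1)] q(2) by simp
    have inj: "inj ?D"
      using inj_on_differential[OF qp] inj_coord_vec[OF c q(1)] q(2)
      by (auto simp: tan D inj_on_def)
    have e: "(\<lambda>i. e i x) = ?D \<circ> (\<lambda>i. axis i 1)" by (auto simp: e_def)
    have axes: "range (\<lambda>i. axis i 1) = (Basis :: (real ^ 'm) set)"
      by (auto simp: Basis_vec_def)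
    have im: "(\<lambda>i. e i x) ` set xs = ?D ` Basis"
      unfolding e image_comp[symmetric] xs axes ..
    show "span ((\<lambda>i. e i x) ` set xs) = (\<lambda>v. deriv_along v f) ` tangent_space A ?q"
      unfolding im linear_span_image[OF lin] tan by (auto simp: D)
    have "independent (?D ` Basis)"
      using linear_independent_injective_image[OF lin independent_Basis] inj by (simp add: inj_on_subset)
    moreover have "inj (\<lambda>i. e i x)"
      unfolding e using inj by (intro inj_compose) (auto simp: inj_on_def axis_eq_axis)
    ultimately show "inj_on (\<lambda>i. e i x) (set xs) \<and> independent ((\<lambda>i. e i x) ` set xs)"
      unfolding im by (simp add: xs)
  qed
  have tan_PT: "(\<lambda>v. deriv_along v f) ` tangent_space A (chart_inv c x) \<subseteq> prod_tangent k1 k2 (?\<phi> x)"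
    if "x \<in> ?S" for x
    using differential_in_prod_tangent[OF chart_inv_in_points[OF c that]] by blast
  have pos: "positive_on B (span ((\<lambda>i. e i x) ` set xs))" if x: "x \<in> ?S" for x
    using positive_on_PT[OF chart_inv_in_points[OF c x]] tan_PT[OF x] frame(1)[OF x]
    by (auto simp: positive_on_def)
  let ?G = "\<lambda>x. gram_schmidt B (map (\<lambda>i. e i x) xs) (P x)"
  have e_smooth: "smooth_on ?S (e i)" for i
    unfolding e_def by (rule smooth_on_frechet_derivative[OF \<phi>_smooth])
  have "smooth_on ?S ?G"
    by (rule smooth_on_gram_schmidt[OF S bounded_bilinear_prod_form e_smooth P xs(2) pos frame(2)])
  then have "smooth_on ?S (\<lambda>x. P x - ?G x)" by (rule smooth_on_diff[OF S P])
  moreover have "nor (chart_inv c x) (?F x) = P x - ?G x" if x: "x \<in> ?S" for x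
  proof (rule nor_eqI)
    let ?q = "chart_inv c x"
    show qp: "?q \<in> points A" by (rule chart_inv_in_points[OF c x])
    have Pproj: "P x = orth_proj B (prod_tangent k1 k2 (?\<phi> x)) (?F x)"
      unfolding P_def by (rule orth_proj_prod_tangent[OF f_in_product[OF qp], symmetric])
    have "P x \<in> prod_tangent k1 k2 (?\<phi> x)"
      unfolding Pproj
      by (rule orth_proj_in[OF bounded_bilinear_prod_form symmetric_form_prod_form
          subspace_prod_tangent positive_on_PT[OF qp]])
    moreover have G: "?G x \<in> (\<lambda>v. deriv_along v f) ` tangent_space A ?q"
      using gram_schmidt_in_span[of B "map (\<lambda>i. e i x) xs" "P x"] frame(1)[OF x] by simp
    ultimately have "P x - ?G x \<in> prod_tangent k1 k2 (?\<phi> x)"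
      using tan_PT[OF x] by (intro subspace_diff[OF subspace_prod_tangent]) auto
    moreover have "B (P x - ?G x) (deriv_along v f) = 0" if "v \<in> tangent_space A ?q" for v
      by (rule gram_schmidt_orthogonal[OF bounded_bilinear_prod_form symmetric_form_prod_form])
        (use pos[OF x] frame(1)[OF x] that in auto)
    ultimately show "P x - ?G x \<in> N ?q" by (simp add: normal_space_def)
    fix z assume z: "z \<in> N ?q"
    have "B (?F x - P x) z = 0"
      unfolding Pproj
      by (rule orth_proj_orthogonal[OF bounded_bilinear_prod_form symmetric_form_prod_form
            subspace_prod_tangent positive_on_PT[OF qp]])
        (use z N_subset in blast)
    moreover have "B (?G x) z = 0"
    proof -
      obtain v where "v \<in> tangent_space A ?q" "?G x = deriv_along v f" using G by blast
      then show ?thesis by (simp add: B_commute[of _ z] N_orthogonal[OF z])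
    qed
    ultimately show "B (?F x - (P x - ?G x)) z = 0" by (simp add: B.diff_left)
  qed
  ultimately show "smooth_on ?S (\<lambda>x. nor (chart_inv c x) (?F x))"
    by (subst smooth_on_cong[OF S]) auto
qed

lemma smooth_df: "Y \<in> vector_fields A \<Longrightarrow> smooth_map A (\<lambda>q. deriv_along (Y q) f)"
  by (rule smooth_map_deriv_along[OF _ smooth_f])

section \<open>The second fundamental form\<close>

lemma second_fundamental_form_eq:
  "p \<in> points A \<Longrightarrow> second_fundamental_form A k1 k2 f X Y p =
    nor p (deriv_along (X p) (\<lambda>q. deriv_along (Y q) f))"
  by (simp add: second_fundamental_form_def nor_ambient_connection)

text \<open>A Levi-Civita connection is torsion-free, so the bracket is a difference of two vector
  fields and no computation in coordinates is needed.\<close>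

lemma lie_bracket_in_tangent_space:
  assumes "X \<in> vector_fields A" "Y \<in> vector_fields A" "p \<in> points A"
  shows "lie_bracket X Y p \<in> tangent_space A p"
proof -
  have "nabla X Y \<in> vector_fields A" "nabla Y X \<in> vector_fields A"
    and eq: "(\<lambda>h. nabla X Y p h - nabla Y X p h) = lie_bracket X Y p"
    using levi_civita assms unfolding levi_civita_connection_def by blast+
  then have "(\<lambda>h. 1 * nabla X Y p h + (-1) * nabla Y X p h) \<in> tangent_space A p"
    using assms(3) by (intro tangent_space_lincomb vector_field_at)
  then show ?thesis by (simp add: eq)
qed

text \<open>The difference of the two sides is the normal part of the differential of
  \<open>f\<close> on the bracket, a tangent vector.\<close>

lemma second_fundamental_form_commute:
  assumes "X \<in> vector_fields A" "Y \<in> vector_fields A" "p \<in> points A"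
  shows "second_fundamental_form A k1 k2 f X Y p = second_fundamental_form A k1 k2 f Y X p"
proof -
  have "nor p (deriv_along (lie_bracket X Y p) f) = 0"
    by (rule nor_differential[OF assms(3) lie_bracket_in_tangent_space[OF assms]])
  then show ?thesis
    by (simp add: deriv_along_lie_bracket second_fundamental_form_eq nor_diff assms(3))
qed

text \<open>The right-hand side visibly depends on \<open>X\<close> only through \<open>X p\<close>;
  symmetry carries this over to \<open>Y\<close>. Hence the extensions chosen in the definition may
  be exchanged for the given fields, one slot at a time.\<close>

lemma \<alpha>_eq:
  assumes X: "X \<in> vector_fields A" and Y: "Y \<in> vector_fields A" and p: "p \<in> points A"
  shows "\<alpha> p (X p) (Y p) = nor p (deriv_along (X p) (\<lambda>q. deriv_along (Y q) f))"
proof -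
  define X' where "X' = (SOME X'. X' \<in> vector_fields A \<and> X' p = X p)"
  define Y' where "Y' = (SOME Y'. Y' \<in> vector_fields A \<and> Y' p = Y p)"
  have X': "X' \<in> vector_fields A" "X' p = X p"
    using someI[of "\<lambda>X'. X' \<in> vector_fields A \<and> X' p = X p" X] X by (auto simp: X'_def)
  have Y': "Y' \<in> vector_fields A" "Y' p = Y p"
    using someI[of "\<lambda>Y'. Y' \<in> vector_fields A \<and> Y' p = Y p" Y] Y by (auto simp: Y'_def)
  let ?s = "\<lambda>X Y. second_fundamental_form A k1 k2 f X Y p"
  have "\<alpha> p (X p) (Y p) = ?s X' Y'"
    by (simp add: second_fundamental_form_at_def X'_def Y'_def)
  also have "\<dots> = ?s X Y'" by (simp add: second_fundamental_form_eq p X'(2))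
  also have "\<dots> = ?s Y' X" by (rule second_fundamental_form_commute[OF X Y'(1) p])
  also have "\<dots> = ?s Y X" by (simp add: second_fundamental_form_eq p Y'(2))
  also have "\<dots> = ?s X Y" by (rule second_fundamental_form_commute[OF Y X p])
  finally show ?thesis by (simp add: second_fundamental_form_eq p)
qed

lemma \<alpha>_eq':
  assumes "v \<in> tangent_space A p" "Y \<in> vector_fields A" "p \<in> points A"
  shows "\<alpha> p v (Y p) = nor p (deriv_along v (\<lambda>q. deriv_along (Y q) f))"
proof -
  obtain X where "X \<in> vector_fields A" "X p = v" using vector_field_extension assms by blast
  then show ?thesis using \<alpha>_eq[of X Y p] assms by simp
qed

lemma \<alpha>_commute:
  assumes "p \<in> points A" "v \<in> tangent_space A p" "w \<in> tangent_space A p"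
  shows "\<alpha> p v w = \<alpha> p w v"
proof -
  obtain X where X: "X \<in> vector_fields A" "X p = v" using vector_field_extension assms by blast
  obtain Y where Y: "Y \<in> vector_fields A" "Y p = w" using vector_field_extension assms by blast
  show ?thesis
    using second_fundamental_form_commute[OF X(1) Y(1) assms(1)] \<alpha>_eq[OF X(1) Y(1) assms(1)]
      \<alpha>_eq[OF Y(1) X(1) assms(1)] by (simp add: X(2) Y(2) second_fundamental_form_eq assms(1))
qed

lemma \<alpha>_sum_left:
  assumes p: "p \<in> points A" and u: "\<And>i. i \<in> I \<Longrightarrow> u i \<in> tangent_space A p"
    and v: "(\<lambda>h. \<Sum>i\<in>I. a i * u i h) \<in> tangent_space A p" and w: "w \<in> tangent_space A p"
  shows "\<alpha> p (\<lambda>h. \<Sum>i\<in>I. a i * u i h) w = (\<Sum>i\<in>I. a i *\<^sub>R \<alpha> p (u i) w)"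
proof -
  obtain Y where Y: "Y \<in> vector_fields A" "Y p = w" using vector_field_extension p w by blast
  have "\<alpha> p (u i) w = nor p (deriv_along (u i) (\<lambda>q. deriv_along (Y q) f))" if "i \<in> I" for i
    using \<alpha>_eq'[OF u[OF that] Y(1) p] by (simp add: Y(2))
  then show ?thesis
    using \<alpha>_eq'[OF v Y(1) p] by (simp add: Y(2) deriv_along_sum nor_sum[OF p] nor_scaleR[OF p])
qed

lemma B_\<alpha>:
  assumes "p \<in> points A" "\<zeta> \<in> N p" "v \<in> tangent_space A p" "Y \<in> vector_fields A"
  shows "B \<zeta> (\<alpha> p v (Y p)) = B \<zeta> (deriv_along v (\<lambda>q. deriv_along (Y q) f))"
  using B_nor[OF assms(1,2)] \<alpha>_eq'[OF assms(3,4,1)] by (simp add: B_commute)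

text \<open>Obtained by differentiating the orthogonality of \<eta> and the image of a tangent
  field. Shape operators appear only through this pairing and are not defined separately.\<close>

lemma weingarten:
  assumes p: "p \<in> points A" and v: "v \<in> tangent_space A p" and w: "w \<in> tangent_space A p"
    and \<eta>: "smooth_map A \<eta>" "\<And>q. q \<in> points A \<Longrightarrow> \<eta> q \<in> N q"
  shows "B (deriv_along v \<eta>) (deriv_along w f) = - B (\<eta> p) (\<alpha> p v w)"
proof -
  obtain W where W: "W \<in> vector_fields A" "W p = w" using vector_field_extension p w by blast
  have "B (\<eta> q) (deriv_along (W q) f) = 0" if "q \<in> points A" for q
    using N_orthogonal[OF \<eta>(2)] vector_field_at[OF W(1)] that by blast
  from deriv_along_bilinear_zero[OF bounded_bilinear_prod_form p v \<eta>(1) smooth_df[OF W(1)] this]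
  show ?thesis using B_\<alpha>[OF p \<eta>(2) v W(1)] p by (simp add: W(2))
qed

section \<open>Orthonormal frames and the mean curvature\<close>

text \<open>A tangent space is a mere set of functionals. Transporting the metric to
  \<open>real ^ 'm\<close> makes linear algebra applicable; positivity comes from the injectivity of
  the differential and of the chart coefficients.\<close>

lemma coordinate_metric:
  assumes c: "c \<in> A" and p: "p \<in> fst c"
  defines "G \<equiv> \<lambda>w w'. g p (coord_vec A c (snd c p) w) (coord_vec A c (snd c p) w')"
  shows "bounded_bilinear G" "symmetric_form G" "positive_on G UNIV"
proof -
  let ?V = "coord_vec A c (snd c p)"
  let ?D = "frechet_derivative (\<lambda>x. f (chart_inv c x)) (at (snd c p))"
  have pp: "p \<in> points A" using chart_subset_points[OF c] p by blast
  have V: "?V w \<in> tangent_space A p" for w by (simp add: tangent_space_eq_range[OF c p])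
  have D: "?D w = deriv_along (?V w) f" for w
    using deriv_along_coord_vec[OF smooth_f c p] by simp
  have lin: "bounded_linear ?D"
    using smooth_map_has_derivative[OF smooth_f c p] by (rule has_derivative_bounded_linear)
  have G: "G = (\<lambda>w w'. B (?D w) (?D w'))"
    by (simp add: G_def metric_eq[OF pp V V] D)
  show "bounded_bilinear G" unfolding G by (rule B.comp[OF lin lin])
  show "symmetric_form G" by (simp add: symmetric_form_def G B_commute)
  show "positive_on G UNIV"
    unfolding positive_on_def
  proof (intro ballI impI)
    fix w :: "real ^ 'm" assume "w \<noteq> 0"
    then have "?V w \<noteq> ?V 0" using inj_coord_vec[OF c p] by (simp add: inj_eq)
    then have "?D w \<noteq> ?D 0"
      unfolding D using inj_onD[OF inj_on_differential[OF pp] _ V V, of w 0] by auto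
    then have "?D w \<noteq> 0" using linear_0[OF bounded_linear.linear[OF lin]] by simp
    then show "G w w > 0"
      using positive_on_PT[OF pp] differential_in_prod_tangent[OF pp V]
      by (simp add: positive_on_def G D)
  qed
qed

lemma coord_vec_sum:
  assumes c: "c \<in> A" and p: "p \<in> fst c"
  shows "coord_vec A c (snd c p) (\<Sum>i\<in>I. a i *\<^sub>R w i) =
    (\<lambda>h. \<Sum>i\<in>I. a i * coord_vec A c (snd c p) (w i) h)"
proof
  fix h
  let ?V = "coord_vec A c (snd c p)"
  have lin: "linear (\<lambda>w. ?V w h)"
  proof (rule linearI)
    show "?V (u + v) h = ?V u h + ?V v h" for u v
      using fun_cong[OF coord_vec_lincomb[OF c p, of 1 u 1 v], of h] by simp
    show "?V (r *\<^sub>R u) h = r *\<^sub>R ?V u h" for r u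
      using fun_cong[OF coord_vec_lincomb[OF c p, of r u 0 0], of h] by simp
  qed
  show "?V (\<Sum>i\<in>I. a i *\<^sub>R w i) h = (\<Sum>i\<in>I. a i * ?V (w i) h)"
    by (simp add: linear_sum[OF lin] linear_scale[OF lin])
qed

lemma orthonormal_frame_exists:
  assumes p: "p \<in> points A"
  obtains e where "orthonormal_frame A g p e"
proof -
  obtain c where c: "c \<in> A" "p \<in> fst c" using p by (rule pointsE)
  let ?V = "coord_vec A c (snd c p)"
  obtain \<epsilon> where "\<forall>i j. g p (?V (\<epsilon> i)) (?V (\<epsilon> j)) = (if i = (j::'m) then 1 else 0)"
    using orthonormal_family_exists[OF coordinate_metric[OF c]] by blast
  then have "orthonormal_frame A g p (\<lambda>i. ?V (\<epsilon> i))"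
    by (simp add: orthonormal_frame_def tangent_space_eq_range[OF c])
  then show ?thesis by (rule that)
qed

lemma frame_expansion:
  assumes p: "p \<in> points A" and e: "orthonormal_frame A g p e" and v: "v \<in> tangent_space A p"
  shows "v = (\<lambda>h. \<Sum>i\<in>UNIV. g p v (e i) * e i h)"
proof -
  obtain c where c: "c \<in> A" "p \<in> fst c" using p by (rule pointsE)
  let ?V = "coord_vec A c (snd c p)"
  note tan = tangent_space_eq_range[OF c]
  have "\<forall>i. \<exists>w. e i = ?V w" using e by (auto simp: orthonormal_frame_def tan)
  then obtain \<epsilon> where \<epsilon>: "\<And>i. e i = ?V (\<epsilon> i)" by metis
  obtain w where w: "v = ?V w" using v by (auto simp: tan)
  have "w = (\<Sum>i\<in>UNIV. g p (?V w) (?V (\<epsilon> i)) *\<^sub>R \<epsilon> i)"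
    by (rule orthonormal_family_expansion[OF coordinate_metric(1)[OF c]])
      (use e in \<open>simp add: orthonormal_frame_def \<epsilon>\<close>)
  then have "?V w = ?V (\<Sum>i\<in>UNIV. g p (?V w) (?V (\<epsilon> i)) *\<^sub>R \<epsilon> i)" by (rule arg_cong)
  then show ?thesis unfolding coord_vec_sum[OF c] w \<epsilon> .
qed

lemma frame_in: "orthonormal_frame A g p e \<Longrightarrow> e i \<in> tangent_space A p"
  by (simp add: orthonormal_frame_def)

lemma \<alpha>_expansion:
  assumes p: "p \<in> points A" and e: "orthonormal_frame A g p e"
    and v: "v \<in> tangent_space A p" and w: "w \<in> tangent_space A p"
  shows "\<alpha> p v w = (\<Sum>i\<in>UNIV. g p v (e i) *\<^sub>R \<alpha> p (e i) w)"
proof -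
  note eq = frame_expansion[OF p e v]
  have "\<alpha> p v w = \<alpha> p (\<lambda>h. \<Sum>i\<in>UNIV. g p v (e i) * e i h) w" by (subst eq) rule
  also have "\<dots> = (\<Sum>i\<in>UNIV. g p v (e i) *\<^sub>R \<alpha> p (e i) w)"
    by (rule \<alpha>_sum_left[OF p frame_in[OF e] _ w]) (use v eq in simp)
  finally show ?thesis .
qed

lemma metric_commute:
  "p \<in> points A \<Longrightarrow> v \<in> tangent_space A p \<Longrightarrow> w \<in> tangent_space A p \<Longrightarrow> g p v w = g p w v"
  by (simp add: metric_eq B_commute)

text \<open>One of the two equal arguments is expanded in the other frame; exchanging the sums and
  the symmetry of \<alpha> then allow contraction over the first frame.\<close>

lemma trace_independent_of_frame:
  assumes p: "p \<in> points A" and e: "orthonormal_frame A g p e" and e': "orthonormal_frame A g p e'"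
  shows "(\<Sum>i\<in>UNIV. \<alpha> p (e' i) (e' i)) = (\<Sum>i\<in>UNIV. \<alpha> p (e i) (e i))"
proof -
  note in_e = frame_in[OF e] and in_e' = frame_in[OF e']
  have "(\<Sum>j\<in>UNIV. \<alpha> p (e' j) (e' j)) = (\<Sum>j\<in>UNIV. \<Sum>i\<in>UNIV. g p (e' j) (e i) *\<^sub>R \<alpha> p (e i) (e' j))"
    by (intro sum.cong refl \<alpha>_expansion[OF p e in_e' in_e'])
  also have "\<dots> = (\<Sum>i\<in>UNIV. \<Sum>j\<in>UNIV. g p (e i) (e' j) *\<^sub>R \<alpha> p (e' j) (e i))"
    by (subst sum.swap) (simp add: \<alpha>_commute[OF p in_e in_e'] metric_commute[OF p in_e' in_e])
  also have "\<dots> = (\<Sum>i\<in>UNIV. \<alpha> p (e i) (e i))"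
    by (intro sum.cong refl \<alpha>_expansion[OF p e' in_e in_e, symmetric])
  finally show ?thesis .
qed

text \<open>The description asks for one value that serves all frames: it exists because the trace
  does not depend on the frame, and it is unique because the frame \<open>e\<close> exists.\<close>

lemma mean_curvature_eq:
  fixes e :: "'m \<Rightarrow> 'a tvec"
  assumes p: "p \<in> points A" and e: "orthonormal_frame A g p e"
  shows "mean_curvature A g k1 k2 f p = (1 / real CARD('m)) *\<^sub>R (\<Sum>i\<in>UNIV. \<alpha> p (e i) (e i))"
  unfolding mean_curvature_def
proof (rule the_equality)
  show "\<forall>e'. orthonormal_frame A g p e' \<longrightarrow> (1 / real CARD('m)) *\<^sub>R (\<Sum>i\<in>UNIV. \<alpha> p (e i) (e i)) =
      (1 / real CARD('m)) *\<^sub>R (\<Sum>i\<in>UNIV. \<alpha> p (e' i) (e' i))"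
  proof (intro allI impI)
    fix e' :: "'m \<Rightarrow> 'a tvec" assume "orthonormal_frame A g p e'"
    from trace_independent_of_frame[OF p e this]
    show "(1 / real CARD('m)) *\<^sub>R (\<Sum>i\<in>UNIV. \<alpha> p (e i) (e i)) =
      (1 / real CARD('m)) *\<^sub>R (\<Sum>i\<in>UNIV. \<alpha> p (e' i) (e' i))" by (simp only:)
  qed
qed (use e in blast)

section \<open>The Weingarten formula and the Ricci equation\<close>

text \<open>A normal component to the product would be measured, factor by factor, by the pairing of
  \<eta> with the differential of \<open>f\<close>. In the second factor \<eta> vanishes at
  \<open>p\<close>, so there the pairing is 0; in the first it equals the full pairing, which is 0
  because \<eta> is normal.\<close>

lemma deriv_along_normal_in_prod_tangent:
  assumes p: "p \<in> points A" and v: "v \<in> tangent_space A p"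
    and \<eta>: "smooth_map A \<eta>" "\<And>q. q \<in> points A \<Longrightarrow> \<eta> q \<in> N q" and snd: "snd (\<eta> p) = 0"
  shows "deriv_along v \<eta> \<in> prod_tangent k1 k2 (f p)"
proof -
  have fst_lin: "deriv_along v (\<lambda>q. fst (F q)) = fst (deriv_along v F)"
    and snd_lin: "deriv_along v (\<lambda>q. snd (F q)) = snd (deriv_along v F)"
    if "smooth_map A F" for F :: "'a \<Rightarrow> ('n1, 'n2) prod_ambient"
    using deriv_along_linear[OF bounded_linear_fst p v that]
      deriv_along_linear[OF bounded_linear_snd p v that] .
  have z2: "flat_form k2 x 0 = 0" "flat_form k2 0 x = 0" for x :: "'n2 ambient"
    by (rule bounded_bilinear.zero_right[OF bounded_bilinear_flat_form]
        bounded_bilinear.zero_left[OF bounded_bilinear_flat_form])+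
  have \<eta>_PT: "fst (\<eta> q) \<in> space_form_tangent k1 (fst (f q))" "snd (\<eta> q) \<in> space_form_tangent k2 (snd (f q))"
    if "q \<in> points A" for q
    using \<eta>(2)[OF that] N_subset[of q] by (auto simp: prod_tangent_def)
  have "B (\<eta> p) (deriv_along v f) = 0" using \<eta>(2)[OF p] v by (rule N_orthogonal)
  then have "flat_form k1 (fst (deriv_along v f)) (fst (\<eta> p)) = 0"
    using snd by (simp add: prod_form_def flat_form_commute z2)
  then have "deriv_along v (\<lambda>q. fst (\<eta> q)) \<in> space_form_tangent k1 (fst (f p))"
    by (intro deriv_along_space_form_tangent[OF p v, where F = "\<lambda>q. fst (f q)"] \<eta>_PT
        smooth_map_linear[OF bounded_linear_fst] smooth_f \<eta>(1)) (simp_all add: fst_lin[OF smooth_f])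
  moreover have "deriv_along v (\<lambda>q. snd (\<eta> q)) \<in> space_form_tangent k2 (snd (f p))"
    by (intro deriv_along_space_form_tangent[OF p v, where F = "\<lambda>q. snd (f q)"] \<eta>_PT
        smooth_map_linear[OF bounded_linear_snd] smooth_f \<eta>(1)) (simp_all add: snd z2)
  ultimately show ?thesis
    by (simp add: prod_tangent_def mem_Times_iff fst_lin[OF \<eta>(1)] snd_lin[OF \<eta>(1)])
qed

lemma smooth_D_perp:
  assumes "X \<in> vector_fields A" "smooth_map A \<xi>"
  shows "smooth_map A (D_perp X \<xi>)"
proof -
  have "smooth_map A (\<lambda>q. nor q (deriv_along (X q) \<xi>))"
    by (rule smooth_nor[OF smooth_map_deriv_along[OF assms]])
  then show ?thesis using smooth_map_cong[of "D_perp X \<xi>"] D_perp_eq by simp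
qed

lemma D_perp_in: "p \<in> points A \<Longrightarrow> D_perp X \<xi> p \<in> N p"
  by (simp add: D_perp_eq nor_in)

text \<open>The Weingarten formula, with the sum being the shape operator of \<eta> applied to
  \<open>v\<close>, written in the frame. Adding the sum to the derivative gives a vector orthogonal
  to the image of the tangent space, which is therefore the normal part.\<close>

lemma tangential_part:
  assumes p: "p \<in> points A" and e: "orthonormal_frame A g p e" and v: "v \<in> tangent_space A p"
    and \<eta>: "smooth_map A \<eta>" "\<And>q. q \<in> points A \<Longrightarrow> \<eta> q \<in> N q" and snd: "snd (\<eta> p) = 0"
  shows "deriv_along v \<eta> - nor p (deriv_along v \<eta>) =
    - (\<Sum>s\<in>UNIV. B (\<eta> p) (\<alpha> p v (e s)) *\<^sub>R deriv_along (e s) f)"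
proof -
  let ?t = "\<Sum>s\<in>UNIV. B (\<eta> p) (\<alpha> p v (e s)) *\<^sub>R deriv_along (e s) f"
  note in_e = frame_in[OF e]
  have "?t \<in> prod_tangent k1 k2 (f p)"
    by (intro subspace_sum subspace_scale subspace_prod_tangent differential_in_prod_tangent p in_e)
  then have PT: "deriv_along v \<eta> + ?t \<in> prod_tangent k1 k2 (f p)"
    by (intro subspace_add subspace_prod_tangent deriv_along_normal_in_prod_tangent[OF p v \<eta> snd])
  have "B (deriv_along v \<eta> + ?t) (deriv_along w f) = 0" if w: "w \<in> tangent_space A p" for w
  proof -
    have "B ?t (deriv_along w f) = (\<Sum>s\<in>UNIV. g p w (e s) * B (\<eta> p) (\<alpha> p (e s) v))"
      by (simp add: B.sum_left B.scaleR_left metric_eq[OF p w in_e] B_commute[of "deriv_along w f"]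
          \<alpha>_commute[OF p v in_e] mult.commute)
    also have "\<dots> = B (\<eta> p) (\<alpha> p w v)"
      by (simp add: \<alpha>_expansion[OF p e w v] B.sum_right B.scaleR_right)
    also have "\<dots> = B (\<eta> p) (\<alpha> p v w)" by (simp add: \<alpha>_commute[OF p w v])
    finally show ?thesis using weingarten[OF p v w \<eta>] by (simp add: B.add_left)
  qed
  then have "deriv_along v \<eta> + ?t \<in> N p" using PT by (simp add: normal_space_def)
  moreover have "B ?t z = 0" if "z \<in> N p" for z
    using N_orthogonal[OF that in_e] by (simp add: B_commute[of _ z] B.sum_right B.scaleR_right)
  ultimately have "nor p (deriv_along v \<eta>) = deriv_along v \<eta> + ?t"
    by (intro nor_eqI[OF p]) (simp_all add: B.minus_left B.diff_left B.add_left)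
  then show ?thesis by simp
qed

text \<open>The hypothesis \<open>snd (\<eta> p) = 0\<close> removes the curvature term of the ambient product.\<close>

lemma ricci_equation:
  assumes p: "p \<in> points A" and e: "orthonormal_frame A g p e"
    and X: "X \<in> vector_fields A" and Y: "Y \<in> vector_fields A"
    and \<eta>: "smooth_map A \<eta>" "\<And>q. q \<in> points A \<Longrightarrow> \<eta> q \<in> N q" and snd: "snd (\<eta> p) = 0"
    and \<zeta>: "\<zeta> \<in> N p"
  shows "B (R_perp X Y \<eta> p) \<zeta> =
    (\<Sum>s\<in>UNIV. B (\<eta> p) (\<alpha> p (Y p) (e s)) * B \<zeta> (\<alpha> p (X p) (e s)))
    - (\<Sum>s\<in>UNIV. B (\<eta> p) (\<alpha> p (X p) (e s)) * B \<zeta> (\<alpha> p (Y p) (e s)))"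
proof -
  note in_e = frame_in[OF e]
  \<comment> \<open>The constant vector \<zeta>, projected at each point, is a smooth normal field
    through \<zeta>, so that pairings with it can be differentiated.\<close>
  define \<zeta>' where "\<zeta>' = (\<lambda>q. nor q \<zeta>)"
  have \<zeta>': "smooth_map A \<zeta>'" "\<And>q. q \<in> points A \<Longrightarrow> \<zeta>' q \<in> N q" "\<zeta>' p = \<zeta>"
    using smooth_nor[OF smooth_map_const] nor_in nor_id[OF p \<zeta>] by (auto simp: \<zeta>'_def)
  have second: "B (D_perp X (D_perp Y \<eta>) p) \<zeta> =
    B (deriv_along (X p) (\<lambda>q. deriv_along (Y q) \<eta>)) \<zeta>
    + (\<Sum>s\<in>UNIV. B (\<eta> p) (\<alpha> p (Y p) (e s)) * B \<zeta> (\<alpha> p (X p) (e s)))"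
    if X: "X \<in> vector_fields A" and Y: "Y \<in> vector_fields A" for X Y
  proof -
    note Xp = vector_field_at[OF X p] and Yp = vector_field_at[OF Y p]
    note bil = deriv_along_bilinear[OF bounded_bilinear_prod_form p Xp _ \<zeta>'(1),
        unfolded deriv_along_real]
    have smooth: "smooth_map A (\<lambda>q. deriv_along (Y q) \<eta>)" "smooth_map A (D_perp Y \<eta>)"
      using smooth_map_deriv_along[OF Y \<eta>(1)] smooth_D_perp[OF Y \<eta>(1)] .
    \<comment> \<open>Against a normal field the normal and the flat derivative of \<eta> pair
      equally. Expanding both sides by the product rule leaves the tangential part of the flat
      derivative, paired with the derivative of \<open>\<zeta>'\<close>: a product of two shape
      operators.\<close>
    have "deriv_along (X p) (\<lambda>q. B (D_perp Y \<eta> q) (\<zeta>' q)) =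
        deriv_along (X p) (\<lambda>q. B (deriv_along (Y q) \<eta>) (\<zeta>' q))"
      by (rule deriv_along_cong[OF p Xp smooth_map_bilinear[OF bounded_bilinear_prod_form smooth(2) \<zeta>'(1)]])
        (simp add: D_perp_eq B_nor \<zeta>'(2))
    then have "B (deriv_along (X p) (D_perp Y \<eta>)) \<zeta> =
        B (deriv_along (X p) (\<lambda>q. deriv_along (Y q) \<eta>)) \<zeta>
        + B (deriv_along (Y p) \<eta> - D_perp Y \<eta> p) (deriv_along (X p) \<zeta>')"
      by (simp add: bil[OF smooth(1)] bil[OF smooth(2)] \<zeta>'(3) B.diff_left)
    also have "B (deriv_along (Y p) \<eta> - D_perp Y \<eta> p) (deriv_along (X p) \<zeta>') =
        (\<Sum>s\<in>UNIV. B (\<eta> p) (\<alpha> p (Y p) (e s)) * B \<zeta> (\<alpha> p (X p) (e s)))"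
    proof -
      have "deriv_along (Y p) \<eta> - D_perp Y \<eta> p =
          - (\<Sum>s\<in>UNIV. B (\<eta> p) (\<alpha> p (Y p) (e s)) *\<^sub>R deriv_along (e s) f)"
        unfolding D_perp_eq[OF p] by (rule tangential_part[OF p e Yp \<eta> snd])
      then show ?thesis
        using weingarten[OF p Xp in_e \<zeta>'(1,2)]
        by (simp add: B.minus_left B.sum_left B.scaleR_left \<zeta>'(3) sum_negf
            B_commute[of "deriv_along (e _) f"])
    qed
    finally show ?thesis by (simp add: D_perp_eq[OF p] B_nor[OF p \<zeta>])
  qed
  \<comment> \<open>This cancels the second flat derivatives left over from the two orders of
    differentiation.\<close>
  have "B (D_perp (lie_bracket X Y) \<eta> p) \<zeta> = B (deriv_along (X p) (\<lambda>q. deriv_along (Y q) \<eta>)) \<zeta>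
      - B (deriv_along (Y p) (\<lambda>q. deriv_along (X q) \<eta>)) \<zeta>"
    by (simp add: D_perp_eq[OF p] B_nor[OF p \<zeta>] deriv_along_lie_bracket B.diff_left)
  then show ?thesis
    using second[OF X Y] second[OF Y X] by (simp add: normal_curvature_def B.diff_left)
qed

section \<open>The kernel of \<open>T\<close> and the complement of the first normal space\<close>

lemma second_factor_proj_normal:
  assumes p: "p \<in> points A" and \<xi>: "\<xi> \<in> N p"
  shows "second_factor_proj k1 k2 f p \<xi> = (0, snd \<xi>)"
  unfolding second_factor_proj_def
proof (rule orth_proj_eqI[OF bounded_bilinear_prod_form])
  let ?W = "{0} \<times> space_form_tangent k2 (snd (f p))"
  show "subspace ?W"
    by (intro subspace_Times subspace_space_form_tangent) simp
  have "?W \<subseteq> prod_tangent k1 k2 (f p)"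
    using subspace_0[OF subspace_space_form_tangent, of k1 "fst (f p)"] by (auto simp: prod_tangent_def)
  then show "positive_on B ?W" using positive_on_PT[OF p] unfolding positive_on_def by blast
  show "(0, snd \<xi>) \<in> ?W" using \<xi> N_subset[of p] by (auto simp: prod_tangent_def)
  show "B (\<xi> - (0, snd \<xi>)) z = 0" if "z \<in> ?W" for z
    using that by (auto simp: prod_form_def flat_form_def)
qed

text \<open>For normal \<open>\<xi>\<close>, \<open>T \<xi>\<close> paired with \<open>\<xi>\<close> is the squared length of the second component, so the
  kernel of \<open>T\<close> consists of the normal vectors tangent to the first factor.\<close>

lemma T_kernel_iff:
  assumes p: "p \<in> points A"
  shows "\<xi> \<in> T_kernel A k1 k2 f p \<longleftrightarrow> \<xi> \<in> N p \<and> snd \<xi> = 0"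
proof (cases "\<xi> \<in> N p")
  case True
  then have T: "T_tensor A k1 k2 f p \<xi> = nor p (0, snd \<xi>)"
    by (simp add: T_tensor_def second_factor_proj_normal[OF p])
  have "snd \<xi> = 0" if "nor p (0, snd \<xi>) = 0"
  proof (rule ccontr)
    assume "snd \<xi> \<noteq> 0"
    moreover have "snd \<xi> \<in> space_form_tangent k2 (snd (f p))" "snd (f p) \<in> space_form k2"
      using True N_subset[of p] f_in_product[OF p] by (auto simp: prod_tangent_def)
    ultimately have "flat_form k2 (snd \<xi>) (snd \<xi>) > 0" using flat_form_positive by blast
    moreover have "B (0, snd \<xi>) \<xi> = 0"
      using B_nor[OF p True, of "(0, snd \<xi>)"] that by (simp add: B.zero_left)
    ultimately show False
      by (simp add: prod_form_def bounded_bilinear.zero_left[OF bounded_bilinear_flat_form])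
  qed
  moreover have "nor p (0, snd \<xi>) = 0" if "snd \<xi> = 0"
    using nor_zero[OF p] that by (simp add: zero_prod_def)
  ultimately show ?thesis using True T by (auto simp: T_kernel_def)
qed (simp add: T_kernel_def)

lemma first_normal_perp_iff:
  "\<xi> \<in> first_normal_perp A k1 k2 f p \<longleftrightarrow>
    \<xi> \<in> N p \<and> (\<forall>v\<in>tangent_space A p. \<forall>w\<in>tangent_space A p. B \<xi> (\<alpha> p v w) = 0)"
proof -
  let ?S = "{\<alpha> p v w | v w. v \<in> tangent_space A p \<and> w \<in> tangent_space A p}"
  have "B \<xi> \<eta> = 0" if "\<forall>x\<in>?S. B \<xi> x = 0" "\<eta> \<in> span ?S" for \<eta>
    using that(2)
  proof (induction rule: span_induct)
    show "subspace {x. B \<xi> x = 0}"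
      by (auto simp: subspace_def B.zero_right B.add_right B.scaleR_right)
  qed (use that(1) in blast)
  then show ?thesis
    unfolding first_normal_perp_def first_normal_space_def by (blast intro: span_base)
qed

lemma kernel_perp_iff:
  "p \<in> points A \<Longrightarrow> \<xi> \<in> L p \<longleftrightarrow> \<xi> \<in> N p \<and> snd \<xi> = 0 \<and>
    (\<forall>v\<in>tangent_space A p. \<forall>w\<in>tangent_space A p. B \<xi> (\<alpha> p v w) = 0)"
  by (auto simp: kernel_perp_def T_kernel_iff first_normal_perp_iff)

section \<open>Sections of the kernel bundle\<close>

context
  fixes \<xi> :: "'a \<Rightarrow> ('n1, 'n2) prod_ambient"
  assumes \<xi>_sec: "\<xi> \<in> sections A L"
begin

lemma section_smooth: "smooth_map A \<xi>"
  using \<xi>_sec by (simp add: sections_def)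

lemma section_normal: "q \<in> points A \<Longrightarrow> \<xi> q \<in> N q"
  using \<xi>_sec by (simp add: sections_def kernel_perp_iff)

lemma section_snd: "q \<in> points A \<Longrightarrow> snd (\<xi> q) = 0"
  using \<xi>_sec by (simp add: sections_def kernel_perp_iff)

lemma section_\<alpha>:
  "q \<in> points A \<Longrightarrow> v \<in> tangent_space A q \<Longrightarrow> w \<in> tangent_space A q \<Longrightarrow> B (\<xi> q) (\<alpha> q v w) = 0"
  using \<xi>_sec by (simp add: sections_def kernel_perp_iff)

lemma deriv_section_normal:
  assumes p: "p \<in> points A" and v: "v \<in> tangent_space A p"
  shows "deriv_along v \<xi> \<in> N p"
proof -
  obtain e where e: "orthonormal_frame A g p e" using orthonormal_frame_exists[OF p] .
  have "deriv_along v \<xi> = nor p (deriv_along v \<xi>)"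
    using tangential_part[OF p e v section_smooth section_normal section_snd[OF p]]
    by (simp add: section_\<alpha>[OF p v frame_in[OF e]])
  then show ?thesis using nor_in[OF p] by metis
qed

lemma D_perp_section:
  "p \<in> points A \<Longrightarrow> X \<in> vector_fields A \<Longrightarrow> D_perp X \<xi> p = deriv_along (X p) \<xi>"
  using deriv_section_normal[OF _ vector_field_at] by (simp add: D_perp_eq nor_id)

lemma snd_D_perp_section:
  assumes p: "p \<in> points A" and X: "X \<in> vector_fields A"
  shows "snd (D_perp X \<xi> p) = 0"
proof -
  note Xp = vector_field_at[OF X p]
  have "snd (deriv_along (X p) \<xi>) = deriv_along (X p) (\<lambda>q. snd (\<xi> q))"
    by (rule deriv_along_linear[OF bounded_linear_snd p Xp section_smooth, symmetric])
  also have "\<dots> = deriv_along (X p) (\<lambda>q. 0)"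
    by (rule deriv_along_cong[OF p Xp smooth_map_linear[OF bounded_linear_snd section_smooth] section_snd])
  also have "\<dots> = 0" by (rule deriv_along_const[OF p Xp])
  finally show ?thesis by (simp add: D_perp_section[OF p X])
qed

text \<open>The inner normal derivative of a section equals the flat one at every point, so the
  curvature is the normal part of a commutator of flat derivatives minus the bracket term, which is
  0.\<close>

lemma R_perp_section:
  assumes p: "p \<in> points A" and X: "X \<in> vector_fields A" and Y: "Y \<in> vector_fields A"
  shows "R_perp X Y \<xi> p = 0"
proof -
  have second: "D_perp X (D_perp Y \<xi>) p = nor p (deriv_along (X p) (\<lambda>q. deriv_along (Y q) \<xi>))"
    if X: "X \<in> vector_fields A" and Y: "Y \<in> vector_fields A" for X Y
    using deriv_along_cong[OF p vector_field_at[OF X p] smooth_D_perp[OF Y section_smooth]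
        D_perp_section[OF _ Y]] by (simp add: D_perp_eq[OF p])
  have "D_perp (lie_bracket X Y) \<xi> p = nor p (deriv_along (X p) (\<lambda>q. deriv_along (Y q) \<xi>))
      - nor p (deriv_along (Y p) (\<lambda>q. deriv_along (X q) \<xi>))"
    by (simp add: D_perp_eq[OF p] deriv_along_lie_bracket nor_diff[OF p])
  then show ?thesis
    by (simp add: normal_curvature_def second[OF X Y] second[OF Y X])
qed

text \<open>Three of the four terms contain the curvature applied to \<xi> itself and vanish. The
  last one survives because \<open>D_perp Z \<xi>\<close> may leave the complement of the first
  normal space and then is no section.\<close>

lemma deriv_R_perp_section:
  assumes p: "p \<in> points A"
    and X: "X \<in> vector_fields A" and Y: "Y \<in> vector_fields A" and Z: "Z \<in> vector_fields A"
  shows "deriv_normal_curvature A k1 k2 f nabla Z X Y \<xi> p = - R_perp X Y (D_perp Z \<xi>) p"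
proof -
  have "nabla Z X \<in> vector_fields A" "nabla Z Y \<in> vector_fields A"
    using levi_civita X Y Z unfolding levi_civita_connection_def by blast+
  then have "R_perp (nabla Z X) Y \<xi> p = 0" "R_perp X (nabla Z Y) \<xi> p = 0"
    using R_perp_section p X Y by auto
  moreover have "D_perp Z (R_perp X Y \<xi>) p = 0"
  proof -
    have "deriv_along (Z p) (\<lambda>q. 0) = deriv_along (Z p) (R_perp X Y \<xi>)"
      by (rule deriv_along_cong[OF p vector_field_at[OF Z p] smooth_map_const])
        (simp add: R_perp_section X Y)
    then show ?thesis
      using deriv_along_const[OF p vector_field_at[OF Z p], of "0 :: ('n1, 'n2) prod_ambient"]
      by (simp add: D_perp_eq[OF p] nor_zero[OF p])
  qed
  ultimately show ?thesis by (simp add: deriv_normal_curvature_def)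
qed

text \<open>The pairing of \<xi> with the second derivatives of \<open>f\<close> is identically 0;
  differentiating it once more yields the left-hand side plus a pairing of \<xi> with third
  derivatives. Exchanging \<open>X\<close> and \<open>Y\<close> alters the latter by a derivative
  along the bracket, where \<xi> again pairs to 0 with \<alpha>.\<close>

lemma codazzi_equation:
  assumes p: "p \<in> points A"
    and X: "X \<in> vector_fields A" and Y: "Y \<in> vector_fields A" and Z: "Z \<in> vector_fields A"
  shows "B (D_perp X \<xi> p) (\<alpha> p (Y p) (Z p)) = B (D_perp Y \<xi> p) (\<alpha> p (X p) (Z p))"
proof -
  let ?DD = "\<lambda>X Y. deriv_along (X p) (\<lambda>q. deriv_along (Y q) (\<lambda>q. deriv_along (Z q) f))"
  have differentiated: "B (D_perp X \<xi> p) (\<alpha> p (Y p) (Z p)) + B (\<xi> p) (?DD X Y) = 0"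
    if X: "X \<in> vector_fields A" and Y: "Y \<in> vector_fields A" for X Y
  proof -
    have "B (\<xi> q) (deriv_along (Y q) (\<lambda>q. deriv_along (Z q) f)) = 0" if q: "q \<in> points A" for q
      using B_\<alpha>[OF q section_normal[OF q] vector_field_at[OF Y q] Z]
        section_\<alpha>[OF q vector_field_at[OF Y q] vector_field_at[OF Z q]] by simp
    from deriv_along_bilinear_zero[OF bounded_bilinear_prod_form p vector_field_at[OF X p]
        section_smooth smooth_map_deriv_along[OF Y smooth_df[OF Z]] this]
    show ?thesis
      using B_\<alpha>[OF p deriv_section_normal[OF p vector_field_at[OF X p]] vector_field_at[OF Y p] Z]
      by (simp add: D_perp_section[OF p X])
  qed
  have bracket: "lie_bracket X Y p \<in> tangent_space A p"
    by (rule lie_bracket_in_tangent_space[OF X Y p])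
  have "B (\<xi> p) (?DD X Y) - B (\<xi> p) (?DD Y X) = 0"
    using B_\<alpha>[OF p section_normal[OF p] bracket Z] section_\<alpha>[OF p bracket vector_field_at[OF Z p]]
    by (simp add: deriv_along_lie_bracket B.diff_right)
  then show ?thesis using differentiated[OF X Y] differentiated[OF Y X] by linarith
qed

end

section \<open>The two implications\<close>

lemma normal_derivatives_imp:
  assumes N1: "normal_derivatives_in A k1 k2 f L (first_normal_perp A k1 k2 f)"
  shows "normal_curvature_parallel_on A k1 k2 f nabla L"
    and "normal_derivatives_in A k1 k2 f L (mean_curvature_perp A g k1 k2 f)"
proof -
  have D: "D_perp X \<xi> p \<in> first_normal_perp A k1 k2 f p"
    if "\<xi> \<in> sections A L" "X \<in> vector_fields A" "p \<in> points A" for \<xi> X p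
    using N1 that by (simp add: normal_derivatives_in_def)
  have "D_perp Z \<xi> \<in> sections A L" if \<xi>: "\<xi> \<in> sections A L" and Z: "Z \<in> vector_fields A" for \<xi> Z
    using D[OF \<xi> Z] smooth_D_perp[OF Z section_smooth[OF \<xi>]] snd_D_perp_section[OF \<xi> _ Z]
    by (auto simp: sections_def kernel_perp_iff first_normal_perp_iff)
  then show "normal_curvature_parallel_on A k1 k2 f nabla L"
    by (auto simp: normal_curvature_parallel_on_def deriv_R_perp_section R_perp_section)
  have "B (D_perp X \<xi> p) (mean_curvature A g k1 k2 f p) = 0"
    if \<xi>: "\<xi> \<in> sections A L" and X: "X \<in> vector_fields A" and p: "p \<in> points A" for \<xi> X p
  proof -
    obtain e where e: "orthonormal_frame A g p e" using orthonormal_frame_exists[OF p] .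
    show ?thesis
      using D[OF \<xi> X p] frame_in[OF e]
      by (simp add: first_normal_perp_iff mean_curvature_eq[OF p e] B.scaleR_right B.sum_right)
  qed
  then show "normal_derivatives_in A k1 k2 f L (mean_curvature_perp A g k1 k2 f)"
    by (auto simp: normal_derivatives_in_def mean_curvature_perp_def D_perp_in)
qed

text \<open>Commutativity at \<open>l = k\<close>, \<open>j = i\<close> turns the squared norm of the \<open>i\<close>-th operator into a sum
  containing the traces as factors.\<close>

lemma symmetric_commuting_trace_free_zero:
  fixes c :: "'i::finite \<Rightarrow> 'i \<Rightarrow> 'i \<Rightarrow> real"
  assumes sym: "\<And>i j k. c i j k = c j i k"
    and commute: "\<And>i l j k. (\<Sum>s\<in>UNIV. c i k s * c l j s) = (\<Sum>s\<in>UNIV. c i j s * c l k s)"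
    and trace: "\<And>i. (\<Sum>j\<in>UNIV. c j j i) = 0"
  shows "c i j k = 0"
proof -
  have "(\<Sum>k\<in>UNIV. \<Sum>s\<in>UNIV. (c i k s)\<^sup>2) = (\<Sum>k\<in>UNIV. \<Sum>s\<in>UNIV. c i k s * c k i s)"
    by (simp add: sym[of _ i] power2_eq_square)
  also have "\<dots> = (\<Sum>k\<in>UNIV. \<Sum>s\<in>UNIV. c i i s * c k k s)"
    by (intro sum.cong refl commute)
  also have "\<dots> = (\<Sum>s\<in>UNIV. c i i s * (\<Sum>k\<in>UNIV. c k k s))"
    by (subst sum.swap) (simp add: sum_distrib_left)
  finally have "(\<Sum>k\<in>UNIV. \<Sum>s\<in>UNIV. (c i k s)\<^sup>2) = 0" by (simp add: trace)
  then show ?thesis by (simp add: sum_nonneg_eq_0_iff sum_nonneg)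
qed

lemma normal_derivatives_if:
  assumes parallel: "normal_curvature_parallel_on A k1 k2 f nabla L"
    and mean: "normal_derivatives_in A k1 k2 f L (mean_curvature_perp A g k1 k2 f)"
  shows "normal_derivatives_in A k1 k2 f L (first_normal_perp A k1 k2 f)"
  unfolding normal_derivatives_in_def
proof (intro ballI)
  fix \<xi> X p assume \<xi>: "\<xi> \<in> sections A L" and X: "X \<in> vector_fields A" and p: "p \<in> points A"
  obtain e where e: "orthonormal_frame A g p e" using orthonormal_frame_exists[OF p] .
  note in_e = frame_in[OF e]
  have "\<exists>E. \<forall>i. E i \<in> vector_fields A \<and> E i p = e i"
    by (rule choice) (use vector_field_extension[OF p in_e] in blast)
  then obtain E where E: "\<And>i. E i \<in> vector_fields A" "\<And>i. E i p = e i" by blast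
  \<comment> \<open>For fixed \<open>i\<close> this is the matrix, in the frame, of the shape
    operator of the normal derivative of \<xi> along \<open>e i\<close>.\<close>
  define c where "c = (\<lambda>i j k. B (D_perp (E i) \<xi> p) (\<alpha> p (e j) (e k)))"
  have codazzi: "B (D_perp Y \<xi> p) (\<alpha> p (e j) (e k)) = B (D_perp (E j) \<xi> p) (\<alpha> p (Y p) (e k))"
    if "Y \<in> vector_fields A" for Y j k
    using codazzi_equation[OF \<xi> p that E(1) E(1), of j k] by (simp add: E(2))
  have c_swap: "c i j k = c i k j" for i j k
    by (simp add: c_def \<alpha>_commute[OF p in_e in_e, of j k])
  have c_sym: "c i j k = c j i k" for i j k
    using codazzi[OF E(1)] by (simp add: c_def E(2))
  have "R_perp (E j) (E k) (D_perp (E i) \<xi>) p = 0" for i j k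
    using parallel \<xi> p E(1) deriv_R_perp_section[OF \<xi> p E(1) E(1) E(1), of i j k]
    by (simp add: normal_curvature_parallel_on_def)
  \<comment> \<open>The Ricci equation for the derivative of \<xi> along \<open>e i\<close>, tested
    against the derivative along \<open>e l\<close>, is the commutator of the \<open>i\<close>-th
    and \<open>l\<close>-th matrices.\<close>
  then have c_commute: "(\<Sum>s\<in>UNIV. c i k s * c l j s) = (\<Sum>s\<in>UNIV. c i j s * c l k s)" for i l j k
    using ricci_equation[OF p e E(1) E(1) smooth_D_perp[OF E(1) section_smooth[OF \<xi>]]
        D_perp_in snd_D_perp_section[OF \<xi> p E(1)] D_perp_in[OF p, of "E l" \<xi>], of j k i]
    by (simp add: c_def E(2) B.zero_left)
  have trace: "(\<Sum>j\<in>UNIV. c j j i) = 0" for i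
  proof -
    have "B (D_perp (E i) \<xi> p) (mean_curvature A g k1 k2 f p) = 0"
      using mean \<xi> p E(1) by (auto simp: normal_derivatives_in_def mean_curvature_perp_def)
    then have "(\<Sum>j\<in>UNIV. c i j j) = 0"
      by (simp add: c_def mean_curvature_eq[OF p e] B.scaleR_right B.sum_right)
    \<comment> \<open>Condition (ii) contracts the last two slots, the algebraic lemma the first
      two; total symmetry reconciles them.\<close>
    moreover have "c i j j = c j j i" for j using c_sym[of i j j] c_swap[of j i j] by simp
    ultimately show ?thesis by simp
  qed
  note c_zero = symmetric_commuting_trace_free_zero[of c, OF c_sym c_commute trace]
  \<comment> \<open>The Codazzi equation moves the arbitrary field \<open>X\<close> into a slot of
    \<alpha>, where it can be expanded in the frame.\<close>
  have zero: "B (D_perp X \<xi> p) (\<alpha> p (e j) (e k)) = 0" for j k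
  proof -
    have "B (D_perp (E j) \<xi> p) (\<alpha> p (X p) (e k)) =
        (\<Sum>i\<in>UNIV. g p (X p) (e i) * c j i k)"
      by (subst \<alpha>_expansion[OF p e vector_field_at[OF X p] in_e])
        (simp add: B.sum_right B.scaleR_right c_def)
    then show ?thesis by (simp add: codazzi[OF X] c_zero)
  qed
  have "B (D_perp X \<xi> p) (\<alpha> p v w) = 0" if v: "v \<in> tangent_space A p" and w: "w \<in> tangent_space A p" for v w
  proof -
    have "B (D_perp X \<xi> p) (\<alpha> p w (e i)) = 0" for i
      by (subst \<alpha>_expansion[OF p e w in_e]) (simp add: B.sum_right B.scaleR_right zero)
    then show ?thesis
      by (subst \<alpha>_expansion[OF p e v w])
        (simp add: B.sum_right B.scaleR_right \<alpha>_commute[OF p in_e w])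
  qed
  then show "D_perp X \<xi> p \<in> first_normal_perp A k1 k2 f p"
    by (simp add: first_normal_perp_iff D_perp_in[OF p])
qed

end

theorem theorem14:
  fixes T :: "'a topology"
    and A :: "('a, 'm::finite) chart set"
    and g :: "'a \<Rightarrow> 'a tvec \<Rightarrow> 'a tvec \<Rightarrow> real"
    and nabla :: "'a vfield \<Rightarrow> 'a vfield \<Rightarrow> 'a vfield"
    and k1 k2 :: real
    and f :: "'a \<Rightarrow> ('n1::finite, 'n2::finite) prod_ambient"
  assumes "riemannian_manifold T A g"
    and "levi_civita_connection A g nabla"
    and "isometric_immersion A g k1 k2 f"
    and "vector_subbundle A k1 k2 f T (kernel_perp A k1 k2 f)"
  shows "normal_derivatives_in A k1 k2 f (kernel_perp A k1 k2 f) (first_normal_perp A k1 k2 f) \<longleftrightarrow>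
         normal_curvature_parallel_on A k1 k2 f nabla (kernel_perp A k1 k2 f) \<and>
         normal_derivatives_in A k1 k2 f (kernel_perp A k1 k2 f) (mean_curvature_perp A g k1 k2 f)"
proof -
  interpret immersion T A g nabla k1 k2 f
    using assms(1-3) by unfold_locales (simp_all add: riemannian_manifold_def)
  show ?thesis using normal_derivatives_imp normal_derivatives_if by blast
qed

end
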